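(* Assume $P_{\gamma g}$ is Fréchet differentiable at $w_\star$, with derivative $Q_\star:=DP_{\gamma g}(w_\star)$. Then the exact DRS map $T=(1-\alpha)I+\alpha R_{\gamma g}R_{\gamma f}$ is Fréchet differentiable at $z_\star$, and $$L_\star:=DT(z_\star)=(1-\alpha)I+\alpha(2Q_\star-I)(2G_\star^{-1}-I).$$ Consequently, for the exact DRS iteration $z_k=Tz_{k-1}$, with $\Delta z_k:=z_k-z_{k-1}$, $$\Delta z_k=(L_\star-I)(z_{k-1}-z_\star)+o(\|z_{k-1}-z_\star\|)\qquad\text{as } z_{k-1}\to z_\star .$$ The same expansion holds for an inexact iteration $z_k=Tz_{k-1}+\varepsilon_k$ whenever its outer perturbation satisfies $\varepsilon_k=o(\|z_{k-1}-z_\star\|)$. Moreover, the differentiability assumption on $P_{\gamma g}$ at $w_\star$ is satisfied in each of the following situations: (a) $g$ is partly smooth at $p_\star$ relative to a locally affine manifold $\mathcal M=p_\star+\mathcal T_\star$, $g|_{\mathcal M}$ is twice continuously differentiable, and $-\nabla f(p_\star)\in\operatorname{ri}\partial g(p_\star)$; (b) $g(x)=\lambda\|x\|_1$ on $\mathcal H=\mathbb R^n$, $\lambda>0$, and $|\nabla_if(p_\star)|<\lambda$ for every $i$ with $p_{\star,i}=0$; (c) (anisotropic discrete TV) $g(x)=\lambda\|Dx\|_1$ with $D$ a linear (finite-difference) operator from $\mathcal H$ to some $\mathbb R^N$, $\lambda>0$, and there is $q_\star\in\mathbb R^N$ with $-\nabla f(p_\star)=\lambda D^*q_\star$, $q_{\star,j}=\operatorname{sign}((Dp_\star)_j)$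 whenever $(Dp_\star)_j\ne0$, and $|q_{\star,j}|<1$ whenever $(Dp_\star)_j=0$; (d) (isotropic/group discrete TV) $g(x)=\lambda\sum_{r=1}^N\|(Dx)_r\|_2$ with $D$ a linear (block-valued finite-difference) operator, $\lambda>0$, and there is $q_\star$ with $-\nabla f(p_\star)=\lambda D^*q_\star$, $q_{\star,r}=(Dp_\star)_r/\|(Dp_\star)_r\|_2$ whenever $(Dp_\star)_r\neq0$, and $\|q_{\star,r}\|_2<1$ whenever $(Dp_\star)_r=0$.
   Context: $\mathcal H$ is a finite-dimensional real Hilbert space, $f:\mathcal H\to\mathbb R$ is convex and twice continuously differentiable, $\sigma$-strongly convex and $\beta$-smooth ($0<\sigma\le\beta$), $g:\mathcal H\to\mathbb R\cup\{+\infty\}$ is proper, closed, convex. For proper closed convex $h$, $P_{\gamma h}u:=\arg\min_x\{\gamma h(x)+\frac12\|x-u\|^2\}$ and $R_{\gamma h}:=2P_{\gamma h}-I$. $\gamma>0$ and $\alpha>0$ satisfy $|1-\alpha|+\alpha\delta<1$, where $\delta:=\max\{\frac{\gamma\beta-1}{\gamma\beta+1},\frac{1-\gamma\sigma}{1+\gamma\sigma}\}$. $z_\star$ is the unique fixed point of $T$, $p_\star:=P_{\gamma f}z_\star$, $w_\star:=R_{\gamma f}z_\star=2p_\star-z_\star$ (so $w_\star=p_\star-\gamma\nabla f(p_\star)$ and $-\nabla f(p_\star)\in\partial g(p_\star)$), and $G_\star:=I+\gamma\nabla^2f(p_\star)$. $\operatorname{ri}$ denotes relative interior. A locally affine manifold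 $\mathcal M=p_\star+\mathcal T_\star$ is a set coinciding near $p_\star$ with the affine subspace $p_\star+\mathcal T_\star$, $\mathcal T_\star$ a linear subspace. The convex function $g$ is partly smooth (in the sense of Lewis) at $p_\star$ relative to $\mathcal M$ if: $g|_{\mathcal M}$ is $C^2$ near $p_\star$; $\partial g(x)\neq\emptyset$ for $x\in\mathcal M$ near $p_\star$; the linear subspace parallel to the affine hull of $\partial g(p_\star)$ equals the normal space $\mathcal T_\star^\perp$; and the set-valued map $\partial g$ restricted to $\mathcal M$ is continuous at $p_\star$. *)

theory Defs
  imports "HOL-Analysis.Analysis" "HOL-Library.Landau_Symbols"
begin

definition ereal_epigraph :: "('a \<Rightarrow> ereal) \<Rightarrow> ('a \<times> real) set" where
  "ereal_epigraph h = {(x, t). h x \<le> ereal t}"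

definition proper_closed_convex :: "('a::real_normed_vector \<Rightarrow> ereal) \<Rightarrow> bool" where
  "proper_closed_convex h \<longleftrightarrow>
     (\<forall>x. h x \<noteq> -\<infinity>) \<and> (\<exists>x. h x \<noteq> \<infinity>) \<and>
     closed (ereal_epigraph h) \<and> convex (ereal_epigraph h)"

definition subdifferential :: "('a::real_inner \<Rightarrow> ereal) \<Rightarrow> 'a \<Rightarrow> 'a set" where
  "subdifferential h x = {v. \<forall>y. h x + ereal (v \<bullet> (y - x)) \<le> h y}"

definition prox :: "real \<Rightarrow> ('a::real_normed_vector \<Rightarrow> ereal) \<Rightarrow> 'a \<Rightarrow> 'a" where
  "prox \<gamma> h u = (ARG_MIN (\<lambda>x. ereal \<gamma> * h x + ereal (1/2 * (norm (x - u))\<^sup>2)) x. True)"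

definition reflected_prox :: "real \<Rightarrow> ('a::real_normed_vector \<Rightarrow> ereal) \<Rightarrow> 'a \<Rightarrow> 'a" where
  "reflected_prox \<gamma> h u = 2 *\<^sub>R prox \<gamma> h u - u"

definition drs_map ::
    "real \<Rightarrow> real \<Rightarrow> ('a::real_normed_vector \<Rightarrow> ereal) \<Rightarrow> ('a \<Rightarrow> ereal) \<Rightarrow> 'a \<Rightarrow> 'a" where
  "drs_map \<alpha> \<gamma> f g z =
     (1 - \<alpha>) *\<^sub>R z + \<alpha> *\<^sub>R reflected_prox \<gamma> g (reflected_prox \<gamma> f z)"

definition strongly_convex :: "real \<Rightarrow> ('a::real_normed_vector \<Rightarrow> real) \<Rightarrow> bool" where
  "strongly_convex \<sigma> f \<longleftrightarrow>
     (\<forall>x y. \<forall>t\<in>{0..1}. f ((1 - t) *\<^sub>R x + t *\<^sub>R y)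
        \<le> (1 - t) * f x + t * f y - \<sigma> / 2 * t * (1 - t) * (norm (x - y))\<^sup>2)"

definition gradient :: "('a::real_inner \<Rightarrow> real) \<Rightarrow> 'a \<Rightarrow> 'a" where
  "gradient f x = (THE v. GDERIV f x :> v)"

definition hessian :: "('a::real_inner \<Rightarrow> real) \<Rightarrow> 'a \<Rightarrow> 'a \<Rightarrow> 'a" where
  "hessian f x = frechet_derivative (gradient f) (at x)"

text \<open>For a relatively open subset S of an affine subspace, the derivatives within S are
  determined only along the direction space. This does not matter here: D1 and D2 may be composed
  with the orthogonal projection onto that space, so C2_on is the intrinsic
  twice continuous differentiability on S.\<close>

definition C2_on :: "'a::real_normed_vector set \<Rightarrow> ('a \<Rightarrow> real) \<Rightarrow> bool" where
  "C2_on S h \<longleftrightarrow>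
     (\<exists>(D1 :: 'a \<Rightarrow> 'a \<Rightarrow>\<^sub>L real) (D2 :: 'a \<Rightarrow> 'a \<Rightarrow>\<^sub>L ('a \<Rightarrow>\<^sub>L real)).
        (\<forall>x\<in>S. (h has_derivative blinfun_apply (D1 x)) (at x within S)) \<and>
        (\<forall>x\<in>S. (D1 has_derivative blinfun_apply (D2 x)) (at x within S)) \<and>
        continuous_on S D2)"

definition C2_near :: "'a::real_normed_vector set \<Rightarrow> 'a \<Rightarrow> ('a \<Rightarrow> ereal) \<Rightarrow> bool" where
  "C2_near M p h \<longleftrightarrow>
     (\<exists>U. open U \<and> p \<in> U \<and> (\<forall>x\<in>M \<inter> U. \<bar>h x\<bar> \<noteq> \<infinity>) \<and>
          C2_on (M \<inter> U) (\<lambda>x. real_of_ereal (h x)))"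

definition locally_affine_manifold ::
    "'a::real_normed_vector set \<Rightarrow> 'a \<Rightarrow> 'a set \<Rightarrow> bool" where
  "locally_affine_manifold M p V \<longleftrightarrow>
     subspace V \<and> (\<exists>U. open U \<and> p \<in> U \<and> M \<inter> U = ((+) p ` V) \<inter> U)"

text \<open>Continuity of a set-valued map relative to M in the Painleve--Kuratowski sense:
  the first conjunct is inner, the second outer semicontinuity at p.\<close>

definition set_valued_continuous_within ::
    "('a::metric_space \<Rightarrow> 'b::metric_space set) \<Rightarrow> 'a \<Rightarrow> 'a set \<Rightarrow> bool" where
  "set_valued_continuous_within F p M \<longleftrightarrow>
     (\<forall>v\<in>F p. \<forall>e>0. \<forall>\<^sub>F x in at p within M. \<exists>u\<in>F x. dist u v < e) \<and>
     (\<forall>x v w. (\<forall>n::nat. x n \<in> M \<and> v n \<in> F (x n)) \<and> x \<longlonglongrightarrow> p \<and> v \<longlonglongrightarrow> w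
        \<longrightarrow> w \<in> F p)"

definition partly_smooth ::
    "('a::euclidean_space \<Rightarrow> ereal) \<Rightarrow> 'a \<Rightarrow> 'a set \<Rightarrow> 'a set \<Rightarrow> bool" where
  "partly_smooth h p M V \<longleftrightarrow>
     C2_near M p h \<and>
     (\<forall>\<^sub>F x in nhds p. x \<in> M \<longrightarrow> subdifferential h x \<noteq> {}) \<and>
     affine_parallel (affine hull (subdifferential h p)) (V\<^sup>\<bottom>) \<and>
     set_valued_continuous_within (subdifferential h) p M"

definition l1_norm :: "'a::euclidean_space \<Rightarrow> real" where
  "l1_norm x = (\<Sum>i\<in>Basis. \<bar>x \<bullet> i\<bar>)"

lemma l1_norm_vec: "l1_norm (x :: real ^ 'n) = (\<Sum>i\<in>UNIV. \<bar>x $ i\<bar>)"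
proof -
  have inj: "inj (\<lambda>i::'n. axis i (1::real))"
    by (auto simp: inj_on_def axis_eq_axis)
  have B: "(Basis :: (real ^ 'n) set) = range (\<lambda>i. axis i 1)"
    by (auto simp: Basis_vec_def)
  show ?thesis
    unfolding l1_norm_def B sum.reindex[OF inj] by (simp add: inner_axis)
qed

end

theory Submission
  imports Defs
begin

text \<open>Since \<open>P\<^bsub>\<gamma>f\<^esub>\<close> inverts \<open>I + \<gamma>\<nabla>f\<close>, it is differentiable with derivative \<open>G\<inverse>\<close>, and the chain rule
  gives \<open>DT\<close>. Cocoercivity of the gradient of \<open>f - \<sigma>/2 \<parallel>\<cdot>\<parallel>\<^sup>2\<close> makes \<open>R\<^bsub>\<gamma>f\<^esub>\<close> a \<open>\<delta>\<close>-contraction, so \<open>T\<close> is a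
  contraction; hence the exact and the perturbed iterations converge and the expansion of \<open>T\<close> at its
  fixed point applies along them.

  For the four situations, put \<open>v = -\<nabla>f(p)\<close>, so \<open>w = p + \<gamma> v\<close>. In each case there is a subspace \<open>V\<close> with
  orthogonal projection \<open>P\<close> such that \<open>g\<close> is smooth along \<open>p + V\<close> near \<open>p\<close>, and every vector near \<open>v\<close>
  whose \<open>V\<close>-component is the gradient of \<open>g\<close> along \<open>p + V\<close> at \<open>x\<close> is a subgradient of \<open>g\<close> at \<open>x\<close>.
  The prox is then found near \<open>w\<close> by solving a smooth strongly monotone equation inside \<open>p + V\<close>.
  Monotonicity of that equation is inherited from the subdifferential, and its local
  solvability follows from invariance of domain.\<close>

section \<open>Proximal maps\<close>

text \<open>Testing the subgradient inequality at a point where \<open>h\<close> is finite bounds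
  \<open>h x\<close> from above. This allows computing with reals wherever a subgradient is
  known.\<close>

lemma subdifferential_finite:
  assumes "proper_closed_convex h" "v \<in> subdifferential h x"
  shows "\<bar>h x\<bar> \<noteq> \<infinity>"
proof -
  obtain y where y: "h y \<noteq> \<infinity>" using assms(1) by (auto simp: proper_closed_convex_def)
  have m: "h x \<noteq> -\<infinity>" using assms(1) by (auto simp: proper_closed_convex_def)
  have "h x + ereal (v \<bullet> (y - x)) \<le> h y" using assms(2) by (auto simp: subdifferential_def)
  with y m show ?thesis by (cases "h x") auto
qed

text \<open>Add the two subgradient inequalities, each tested at the other point; the finite values
  of \<open>h\<close> cancel.\<close>

lemma subdifferential_monotone:
  assumes h: "proper_closed_convex h"
    and v: "v \<in> subdifferential h x" and w: "w \<in> subdifferential h y"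
  shows "0 \<le> (v - w) \<bullet> (x - y)"
proof -
  have fin: "\<bar>h x\<bar> \<noteq> \<infinity>" "\<bar>h y\<bar> \<noteq> \<infinity>" using subdifferential_finite[OF h v] subdifferential_finite[OF h w] by auto
  then obtain a b where ab: "h x = ereal a" "h y = ereal b" by (metis ereal_real')
  have "h x + ereal (v \<bullet> (y - x)) \<le> h y" "h y + ereal (w \<bullet> (x - y)) \<le> h x"
    using v w by (auto simp: subdifferential_def)
  then have "a + v \<bullet> (y - x) \<le> b" "b + w \<bullet> (x - y) \<le> a" by (simp_all add: ab)
  then show ?thesis by (simp add: inner_diff_left inner_diff_right)
qed

text \<open>The membership is Fermat's rule for the prox objective. Strictness of the minimum is
  proved along with it because \<open>prox\<close> picks a minimizer by choice.\<close>

lemma prox_eqI: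
  assumes h: "proper_closed_convex h" and g: "\<gamma> > 0"
    and v: "(1 / \<gamma>) *\<^sub>R (w - p) \<in> subdifferential h p"
  shows "prox \<gamma> h w = p"
proof -
  let ?F = "\<lambda>x. ereal \<gamma> * h x + ereal (1/2 * (norm (x - w))\<^sup>2)"
  obtain a where a: "h p = ereal a" using subdifferential_finite[OF h v] by (metis ereal_real')
  have less: "?F p < ?F y" if "y \<noteq> p" for y
  proof (cases "h y")
    case PInf
    then show ?thesis using g by (simp add: a)
  next
    case MInf
    then show ?thesis using h by (auto simp: proper_closed_convex_def)
  next
    case (real b)
    have "h p + ereal (((1 / \<gamma>) *\<^sub>R (w - p)) \<bullet> (y - p)) \<le> h y"
      using v by (auto simp: subdifferential_def)
    then have "a + (1/\<gamma>) * ((w - p) \<bullet> (y - p)) \<le> b" by (simp add: a real)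
    then have "\<gamma> * (a + (1/\<gamma>) * ((w - p) \<bullet> (y - p))) \<le> \<gamma> * b" using g by (intro mult_left_mono) auto
    then have 1: "\<gamma> * a + (w - p) \<bullet> (y - p) \<le> \<gamma> * b" using g by (simp add: algebra_simps)
    \<comment> \<open>Expanding the square around \<open>p\<close> leaves the surplus
      \<open>(norm (y - p))\<^sup>2\<close>, the source of strictness.\<close>
    have "(norm (y - w))\<^sup>2 = (norm (p - w))\<^sup>2 - 2 * ((w - p) \<bullet> (y - p)) + (norm (y - p))\<^sup>2"
      by (simp add: power2_norm_eq_inner algebra_simps inner_commute)
    moreover have "(norm (y - p))\<^sup>2 > 0" using that by simp
    ultimately have "\<gamma> * a + 1/2 * (norm (p - w))\<^sup>2 < \<gamma> * b + 1/2 * (norm (y - w))\<^sup>2"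
      using 1 by linarith
    then show ?thesis by (simp add: a real)
  qed
  have *: "is_arg_min ?F (\<lambda>x. True) x \<longleftrightarrow> x = p" for x
    using less by (auto simp: is_arg_min_def dest: less_asym)
  show ?thesis unfolding prox_def arg_min_def * by simp
qed

lemma proper_closed_convex_convex:
  assumes h: "proper_closed_convex h" and "h x = ereal a" "h y = ereal b" "0 \<le> t" "t \<le> 1"
  shows "h ((1 - t) *\<^sub>R x + t *\<^sub>R y) \<le> ereal ((1 - t) * a + t * b)"
proof -
  have "convex (ereal_epigraph h)" using h by (simp add: proper_closed_convex_def)
  moreover have "(x, a) \<in> ereal_epigraph h" "(y, b) \<in> ereal_epigraph h"
    using assms by (auto simp: ereal_epigraph_def)
  ultimately have "(1 - t) *\<^sub>R (x, a) + t *\<^sub>R (y, b) \<in> ereal_epigraph h"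
    using assms by (intro convexD) auto
  then show ?thesis by (simp add: ereal_epigraph_def)
qed

text \<open>Separate the epigraph from a point strictly below the graph.\<close>

lemma proper_closed_convex_affine_minorant:
  fixes h :: "'a::euclidean_space \<Rightarrow> ereal"
  assumes h: "proper_closed_convex h"
  obtains v c where "\<And>x t. h x \<le> ereal t \<Longrightarrow> v \<bullet> x + c \<le> t"
proof -
  obtain x0 where "h x0 \<noteq> \<infinity>" "h x0 \<noteq> -\<infinity>" using h by (auto simp: proper_closed_convex_def)
  then obtain t0 where t0: "h x0 = ereal t0" by (cases "h x0") auto
  have E: "closed (ereal_epigraph h)" "convex (ereal_epigraph h)"
    using h by (auto simp: proper_closed_convex_def)
  have "(x0, t0 - 1) \<notin> ereal_epigraph h" by (simp add: ereal_epigraph_def t0)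
  from separating_hyperplane_closed_point[OF E(2,1) this]
  obtain a b where ab: "a \<bullet> (x0, t0 - 1) < b" "\<And>z. z \<in> ereal_epigraph h \<Longrightarrow> b < a \<bullet> z" by blast
  obtain a1 a2 where a: "a = (a1, a2)" by (cases a)
  have "(x0, t0) \<in> ereal_epigraph h" by (simp add: ereal_epigraph_def t0)
  \<comment> \<open>The points \<open>(x0, t0 - 1)\<close> and \<open>(x0, t0)\<close> differ only
    vertically, so strict separation makes the vertical coefficient positive and the hyperplane can
    be solved for \<open>t\<close>.\<close>
  from ab(1) ab(2)[OF this] have a2: "a2 > 0" by (simp add: a algebra_simps)
  show thesis
  proof (rule that)
    fix x t assume "h x \<le> ereal t"
    then have "b < a \<bullet> (x, t)" by (intro ab) (simp add: ereal_epigraph_def)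
    then have "b - a1 \<bullet> x \<le> a2 * t" by (simp add: a)
    then have "(b - a1 \<bullet> x) / a2 \<le> t" using a2 by (simp add: field_simps)
    then show "(- (1/a2) *\<^sub>R a1) \<bullet> x + b / a2 \<le> t" using a2 by (simp add: field_simps)
  qed
qed

text \<open>Weierstrass on the epigraph: lower semicontinuity of \<open>h\<close> becomes closedness
  of a set, and the objective \<open>\<phi>\<close> on pairs is continuous. The affine minorant
  gives compactness.\<close>

lemma prox_exists:
  fixes h :: "'a::euclidean_space \<Rightarrow> ereal"
  assumes h: "proper_closed_convex h" and g: "\<gamma> > 0"
  obtains p a where "h p = ereal a"
    "\<And>y b. h y = ereal b \<Longrightarrow> \<gamma> * a + 1/2 * (norm (p - w))\<^sup>2 \<le> \<gamma> * b + 1/2 * (norm (y - w))\<^sup>2"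
proof -
  obtain v c where vc: "\<And>x t. h x \<le> ereal t \<Longrightarrow> v \<bullet> x + c \<le> t"
    using proper_closed_convex_affine_minorant[OF h] by blast
  obtain x0 where "h x0 \<noteq> \<infinity>" "h x0 \<noteq> -\<infinity>" using h by (auto simp: proper_closed_convex_def)
  then obtain t0 where t0: "h x0 = ereal t0" by (cases "h x0") auto
  define \<phi> where "\<phi> z = \<gamma> * snd z + 1/2 * (norm (fst z - w))\<^sup>2" for z :: "'a \<times> real"
  define K where "K = ereal_epigraph h \<inter> {z. \<phi> z \<le> \<phi> (x0, t0)}"
  have cont: "continuous_on UNIV \<phi>" unfolding \<phi>_def by (intro continuous_intros)
  have "closed {z. \<phi> z \<le> \<phi> (x0, t0)}"
    by (rule closed_Collect_le[OF cont continuous_on_const])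
  then have clK: "closed K" using h by (auto simp: K_def proper_closed_convex_def)
  \<comment> \<open>Inserting the minorant for \<open>t\<close> in the sublevel inequality leaves
    \<open>1/2 * (norm (x - w))\<^sup>2 + \<gamma> * (v \<bullet> (x - w))\<close> on the left.
    Completing a square absorbs the linear term and half of the quadratic one, so a quarter of the
    squared distance stays below \<open>C\<close>.\<close>
  define C where "C = \<phi> (x0, t0) - \<gamma> * (v \<bullet> w) - \<gamma> * c + \<gamma>\<^sup>2 * (norm v)\<^sup>2"
  define r where "r = sqrt (4 * C)"
  have K: "norm (x - w) \<le> r \<and> v \<bullet> x + c \<le> t \<and> t \<le> \<phi> (x0, t0) / \<gamma>" if "(x, t) \<in> K" for x t
  proof -
    have 1: "v \<bullet> x + c \<le> t" using that vc by (auto simp: K_def ereal_epigraph_def)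
    have 2: "\<gamma> * t + 1/2 * (norm (x - w))\<^sup>2 \<le> \<phi> (x0, t0)" using that by (auto simp: K_def \<phi>_def)
    have "\<gamma> * t \<le> \<phi> (x0, t0)" using 2 zero_le_power2[of "norm (x - w)"] by linarith
    then have 3: "t \<le> \<phi> (x0, t0) / \<gamma>" using g by (simp add: field_simps)
    have "\<gamma> * (v \<bullet> x + c) \<le> \<gamma> * t" using 1 g by simp
    moreover have "0 \<le> (norm ((1/2) *\<^sub>R (x - w) + \<gamma> *\<^sub>R v))\<^sup>2" by simp
    then have "0 \<le> 1/4 * (norm (x - w))\<^sup>2 + \<gamma> * (v \<bullet> (x - w)) + \<gamma>\<^sup>2 * (norm v)\<^sup>2"
      unfolding power2_norm_eq_inner
      by (simp add: inner_add_left inner_add_right inner_commute power2_eq_square)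
    ultimately have "1/4 * (norm (x - w))\<^sup>2 \<le> C" using 2
      unfolding C_def by (simp add: inner_diff_right algebra_simps)
    then have "(norm (x - w))\<^sup>2 \<le> 4 * C" by simp
    then have "norm (x - w) \<le> r" unfolding r_def by (rule real_le_rsqrt)
    with 1 3 show ?thesis by blast
  qed
  have "K \<subseteq> cball w r \<times> {c - norm v * (norm w + r) .. \<phi> (x0, t0) / \<gamma>}"
  proof (clarify)
    fix x t assume xt: "(x, t) \<in> K"
    have "\<bar>v \<bullet> x\<bar> \<le> norm v * norm x" by (rule Cauchy_Schwarz_ineq2)
    also have "\<dots> \<le> norm v * (norm w + r)"
      using K[OF xt] norm_triangle_ineq2[of x w] by (intro mult_left_mono) auto
    finally show "x \<in> cball w r \<and> t \<in> {c - norm v * (norm w + r) .. \<phi> (x0, t0) / \<gamma>}"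
      using K[OF xt] by (auto simp: dist_norm norm_minus_commute)
  qed
  then have "bounded K" by (rule bounded_subset[rotated]) (intro bounded_Times bounded_cball bounded_closed_interval)
  then have "compact K" using clK by (simp add: compact_eq_bounded_closed)
  moreover have x0K: "(x0, t0) \<in> K" by (simp add: K_def ereal_epigraph_def t0)
  ultimately obtain z where z: "z \<in> K" "\<And>y. y \<in> K \<Longrightarrow> \<phi> z \<le> \<phi> y"
    using continuous_attains_inf[of K \<phi>] continuous_on_subset[OF cont] by blast
  obtain p t where pt: "z = (p, t)" by (cases z)
  have "h p \<le> ereal t" "h p \<noteq> -\<infinity>" using z(1) pt h by (auto simp: K_def ereal_epigraph_def proper_closed_convex_def)
  then obtain a where a: "h p = ereal a" "a \<le> t" by (cases "h p") auto
  \<comment> \<open>Outside \<open>K\<close> the objective exceeds its value at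
    \<open>(x0, t0)\<close>, a point of \<open>K\<close>, so the minimum over \<open>K\<close> is
    global.\<close>
  have min: "\<phi> z \<le> \<phi> (y, b)" if "h y = ereal b" for y b
  proof (cases "\<phi> (y, b) \<le> \<phi> (x0, t0)")
    case True
    then have "(y, b) \<in> K" using that by (auto simp: K_def ereal_epigraph_def)
    then show ?thesis by (rule z)
  next
    case False
    then show ?thesis using z(2)[OF x0K] by simp
  qed
  have "\<gamma> * a \<le> \<gamma> * t" using a g by simp
  then have "\<gamma> * a + 1/2 * (norm (p - w))\<^sup>2 \<le> \<gamma> * b + 1/2 * (norm (y - w))\<^sup>2" if "h y = ereal b" for y b
    using min[OF that] by (simp add: \<phi>_def pt)
  with a(1) show thesis by (rule that)
qed

text \<open>Compare a minimizer with the points of the segment towards \<open>y\<close>: convexity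
  bounds \<open>h\<close> there, the quadratic contributes a remainder of order
  \<open>t\<^sup>2\<close>, and dividing by \<open>t\<close> before letting it tend to 0 gives the
  subgradient inequality. Then \<open>prox_eqI\<close> identifies the minimizer with
  \<open>prox\<close>.\<close>

lemma prox_subdifferential:
  fixes h :: "'a::euclidean_space \<Rightarrow> ereal"
  assumes h: "proper_closed_convex h" and g: "\<gamma> > 0"
  shows "(1 / \<gamma>) *\<^sub>R (w - prox \<gamma> h w) \<in> subdifferential h (prox \<gamma> h w)"
proof -
  obtain p a where pa: "h p = ereal a"
    and min: "\<And>y b. h y = ereal b \<Longrightarrow> \<gamma> * a + 1/2 * (norm (p - w))\<^sup>2 \<le> \<gamma> * b + 1/2 * (norm (y - w))\<^sup>2"
    using prox_exists[OF h g] by blast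
  have "(1 / \<gamma>) *\<^sub>R (w - p) \<in> subdifferential h p"
    unfolding subdifferential_def
  proof (intro CollectI allI)
    fix y
    show "h p + ereal (((1 / \<gamma>) *\<^sub>R (w - p)) \<bullet> (y - p)) \<le> h y"
    proof (cases "h y")
      case MInf
      then show ?thesis using h by (auto simp: proper_closed_convex_def)
    next
      case (real b)
      have ineq: "(w - p) \<bullet> (y - p) - \<gamma> * (b - a) \<le> t * (1/2 * (norm (y - p))\<^sup>2)" if t: "0 < t" "t \<le> 1" for t
      proof -
        let ?z = "(1 - t) *\<^sub>R p + t *\<^sub>R y"
        have le: "h ?z \<le> ereal ((1 - t) * a + t * b)"
          using t by (intro proper_closed_convex_convex[OF h pa real]) auto
        moreover have "h ?z \<noteq> -\<infinity>" using h by (auto simp: proper_closed_convex_def)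
        ultimately obtain c where c: "h ?z = ereal c" by (cases "h ?z") auto
        have "\<gamma> * c \<le> \<gamma> * ((1 - t) * a + t * b)" using le g by (simp add: c)
        with min[OF c] have "\<gamma> * a + 1/2 * (norm (p - w))\<^sup>2
             \<le> \<gamma> * ((1 - t) * a + t * b) + 1/2 * (norm (?z - w))\<^sup>2" by linarith
        moreover have "?z - w = (p - w) + t *\<^sub>R (y - p)" by (simp add: algebra_simps)
        then have "(norm (?z - w))\<^sup>2 = (norm (p - w))\<^sup>2 - 2 * t * ((w - p) \<bullet> (y - p)) + t\<^sup>2 * (norm (y - p))\<^sup>2"
          unfolding power2_norm_eq_inner
          by (simp add: algebra_simps inner_commute power2_eq_square)
        ultimately have "t * ((w - p) \<bullet> (y - p) - \<gamma> * (b - a)) \<le> t * (t * (1/2 * (norm (y - p))\<^sup>2))"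
          by (simp add: algebra_simps power2_eq_square)
        then show ?thesis using t by simp
      qed
      have "(w - p) \<bullet> (y - p) - \<gamma> * (b - a) \<le> 0"
      proof (rule tendsto_lowerbound)
        show "((\<lambda>t. t * (1/2 * (norm (y - p))\<^sup>2)) \<longlongrightarrow> 0) (at_right 0)"
          by (auto intro!: tendsto_eq_intros)
        show "\<forall>\<^sub>F t in at_right 0. (w - p) \<bullet> (y - p) - \<gamma> * (b - a) \<le> t * (1/2 * (norm (y - p))\<^sup>2)"
          unfolding eventually_at_right_field by (intro exI[of _ 1] conjI allI impI ineq) auto
      qed simp
      then have "a + (1/\<gamma>) * ((w - p) \<bullet> (y - p)) \<le> b" using g by (simp add: field_simps)
      then show ?thesis by (simp add: pa real)
    qed simp
  qed
  with prox_eqI[OF h g this] show ?thesis by simp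
qed

text \<open>Firm nonexpansiveness: monotonicity of the subdifferential applied to the scaled
  residuals.\<close>

lemma prox_monotone:
  fixes h :: "'a::euclidean_space \<Rightarrow> ereal"
  assumes h: "proper_closed_convex h" and g: "\<gamma> > 0"
  shows "(norm (prox \<gamma> h x - prox \<gamma> h y))\<^sup>2 \<le> (x - y) \<bullet> (prox \<gamma> h x - prox \<gamma> h y)"
proof -
  let ?p = "prox \<gamma> h x" and ?q = "prox \<gamma> h y"
  have "0 \<le> ((1 / \<gamma>) *\<^sub>R (x - ?p) - (1 / \<gamma>) *\<^sub>R (y - ?q)) \<bullet> (?p - ?q)"
    using prox_subdifferential[OF h g] by (intro subdifferential_monotone[OF h]) auto
  also have "\<dots> = (1/\<gamma>) * ((x - y) \<bullet> (?p - ?q) - (norm (?p - ?q))\<^sup>2)"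
    by (simp add: power2_norm_eq_inner algebra_simps)
  finally show ?thesis using g by (simp add: field_simps)
qed

text \<open>Expanding the square of \<open>2 *\<^sub>R ?d - (x - y)\<close>, the deviation from
  \<open>(norm (x - y))\<^sup>2\<close> is four times the gap in
  \<open>prox_monotone\<close>.\<close>

lemma reflected_prox_nonexpansive:
  fixes h :: "'a::euclidean_space \<Rightarrow> ereal"
  assumes h: "proper_closed_convex h" and g: "\<gamma> > 0"
  shows "norm (reflected_prox \<gamma> h x - reflected_prox \<gamma> h y) \<le> norm (x - y)"
proof (rule power2_le_imp_le)
  let ?d = "prox \<gamma> h x - prox \<gamma> h y"
  have "reflected_prox \<gamma> h x - reflected_prox \<gamma> h y = 2 *\<^sub>R ?d - (x - y)"
    by (simp add: reflected_prox_def algebra_simps)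
  then have "(norm (reflected_prox \<gamma> h x - reflected_prox \<gamma> h y))\<^sup>2
      = 4 * ((norm ?d)\<^sup>2 - (x - y) \<bullet> ?d) + (norm (x - y))\<^sup>2"
    unfolding power2_norm_eq_inner by (simp add: inner_diff_left inner_diff_right inner_commute)
  then show "(norm (reflected_prox \<gamma> h x - reflected_prox \<gamma> h y))\<^sup>2 \<le> (norm (x - y))\<^sup>2"
    using prox_monotone[OF h g, of x y] by simp
qed simp

section \<open>Gradients of smooth strongly convex functions\<close>

text \<open>Along the line in direction \<open>d\<close>, \<open>h\<close> minus the subgradient's
  linear term has a local minimum at \<open>x\<close>. Since only a segment of that line must lie in
  \<open>S\<close>, the result applies to affine pieces as well as to open sets.\<close>

lemma subgradient_eq_derivative:
  fixes h :: "'a::real_inner \<Rightarrow> ereal"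
  assumes v: "v \<in> subdifferential h x"
    and D: "((\<lambda>y. real_of_ereal (h y)) has_derivative D) (at x within S)"
    and fin: "\<And>y. y \<in> S \<Longrightarrow> \<bar>h y\<bar> \<noteq> \<infinity>"
    and e: "e > 0" "\<And>t. \<bar>t\<bar> < e \<Longrightarrow> x + t *\<^sub>R d \<in> S"
  shows "D d = v \<bullet> d"
proof -
  let ?r = "\<lambda>y. real_of_ereal (h y)"
  let ?l = "\<lambda>t. x + t *\<^sub>R d"
  define \<phi> where "\<phi> t = ?r (?l t) - t * (v \<bullet> d)" for t
  have "(?l has_derivative (\<lambda>t. t *\<^sub>R d)) (at 0 within {-e<..<e})"
    by (auto intro!: derivative_eq_intros)
  moreover have "(?r has_derivative D) (at (?l 0) within ?l ` {-e<..<e})"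
    using e(2) by (auto intro!: has_derivative_subset[OF D])
  ultimately have "((\<lambda>t. ?r (?l t)) has_derivative (\<lambda>t. D (t *\<^sub>R d))) (at 0 within {-e<..<e})"
    by (rule has_derivative_in_compose)
  then have "((\<lambda>t. ?r (?l t)) has_derivative (\<lambda>t. D (t *\<^sub>R d))) (at 0)"
    using e(1) by (subst (asm) at_within_open) auto
  then have "(\<phi> has_derivative (\<lambda>t. D (t *\<^sub>R d) - t * (v \<bullet> d))) (at 0)"
    unfolding \<phi>_def by (auto intro!: derivative_eq_intros)
  moreover have "(\<lambda>t. D (t *\<^sub>R d) - t * (v \<bullet> d)) = (*) (D d - v \<bullet> d)"
    using linear_scale[OF has_derivative_linear[OF D]] by (auto simp: algebra_simps)
  ultimately have 1: "DERIV \<phi> 0 :> D d - v \<bullet> d" by (simp add: has_field_derivative_def)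
  have "\<phi> 0 \<le> \<phi> t" if "\<bar>0 - t\<bar> < e" for t
  proof -
    have "h x + ereal (v \<bullet> (?l t - x)) \<le> h (?l t)" using v unfolding subdifferential_def by blast
    moreover have "\<bar>h x\<bar> \<noteq> \<infinity>" "\<bar>h (?l t)\<bar> \<noteq> \<infinity>"
      using e(2)[of 0] e(2)[of t] that e(1) by (auto intro!: fin)
    ultimately have "?r x + t * (v \<bullet> d) \<le> ?r (?l t)"
      by (cases "h x"; cases "h (?l t)") auto
    then show ?thesis by (simp add: \<phi>_def)
  qed
  then have "D d - v \<bullet> d = 0" using DERIV_local_min[OF 1 e(1)] by blast
  then show ?thesis by simp
qed

lemma GDERIV_unique:
  assumes "GDERIV f x :> v" "GDERIV f x :> w"
  shows "v = w"
proof -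
  have "(\<lambda>h. h \<bullet> v) = (\<lambda>h. h \<bullet> w)"
    using assms unfolding gderiv_def by (rule has_derivative_unique)
  then have "(v - w) \<bullet> v = (v - w) \<bullet> w" by metis
  then have "(v - w) \<bullet> (v - w) = 0" by (simp add: inner_diff_right)
  then show ?thesis by simp
qed

lemma gradient_eqI: "GDERIV f x :> v \<Longrightarrow> gradient f x = v"
  unfolding gradient_def by (blast intro: the_equality GDERIV_unique)

text \<open>Riesz representation in coordinates; it turns derivative functionals into gradient
  vectors.\<close>

lemma linear_eq_inner_sum_Basis:
  fixes D :: "'a::euclidean_space \<Rightarrow> real"
  assumes "linear D"
  shows "D h = h \<bullet> (\<Sum>b\<in>Basis. D b *\<^sub>R b)"
proof -
  have "D h = D (\<Sum>b\<in>Basis. (h \<bullet> b) *\<^sub>R b)" by (simp add: euclidean_representation)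
  also have "\<dots> = h \<bullet> (\<Sum>b\<in>Basis. D b *\<^sub>R b)"
    using assms by (simp add: linear_sum linear_scale inner_sum_right mult.commute)
  finally show ?thesis .
qed

text \<open>Passes from the derivative functionals of \<open>C2_on\<close> to
  \<open>gradient\<close> and \<open>hessian\<close>. Evaluation at a basis vector is bounded
  linear, so the Riesz vector of \<open>D1\<close> inherits the differentiability of
  \<open>D1\<close>.\<close>

lemma C2_gradient_derivatives:
  fixes f :: "'a::euclidean_space \<Rightarrow> real"
  assumes "C2_on UNIV f"
  shows "GDERIV f x :> gradient f x" and "(gradient f has_derivative hessian f x) (at x)"
proof -
  obtain D1 :: "'a \<Rightarrow> 'a \<Rightarrow>\<^sub>L real" and D2 :: "'a \<Rightarrow> 'a \<Rightarrow>\<^sub>L ('a \<Rightarrow>\<^sub>L real)"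
    where D1: "\<And>x. (f has_derivative blinfun_apply (D1 x)) (at x)"
      and D2: "\<And>x. (D1 has_derivative blinfun_apply (D2 x)) (at x)"
    using assms unfolding C2_on_def by auto
  let ?g = "\<lambda>x. \<Sum>b\<in>Basis. D1 x b *\<^sub>R b"
  have "blinfun_apply (D1 x) = (\<lambda>h. h \<bullet> ?g x)" for x
    using linear_eq_inner_sum_Basis[OF bounded_linear.linear[OF blinfun.bounded_linear_right]]
    by (rule ext)
  then have G: "GDERIV f x :> ?g x" for x
    using D1[of x] unfolding gderiv_def by metis
  then have g: "gradient f = ?g" using gradient_eqI by blast
  then show "GDERIV f x :> gradient f x" using G by simp
  have "((\<lambda>x. D1 x b) has_derivative (\<lambda>v. D2 x v b)) (at x)" for b
    by (rule bounded_linear.has_derivative[OF blinfun.bounded_linear_left D2])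
  then have "(?g has_derivative (\<lambda>v. \<Sum>b\<in>Basis. D2 x v b *\<^sub>R b)) (at x)"
    by (intro has_derivative_sum has_derivative_scaleR_left)
  then show "(gradient f has_derivative hessian f x) (at x)"
    unfolding hessian_def g using frechet_derivative_works differentiable_def by blast
qed

text \<open>Divide the strong convexity inequality on the segment by \<open>t\<close> and let
  \<open>t\<close> tend to 0 from the right; the factor \<open>1 - t\<close> tends to 1.\<close>

lemma strongly_convex_lower_bound:
  assumes sc: "strongly_convex \<sigma> f" and v: "GDERIV f x :> v"
  shows "f x + v \<bullet> (y - x) + \<sigma> / 2 * (norm (y - x))\<^sup>2 \<le> f y"
proof -
  let ?l = "\<lambda>t. x + t *\<^sub>R (y - x)"
  have "((\<lambda>t. f (?l t)) has_derivative (\<lambda>t. (t *\<^sub>R (y - x)) \<bullet> v)) (at 0)"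
    by (rule has_derivative_compose[where f = ?l and f' = "\<lambda>t. t *\<^sub>R (y - x)"])
      (use v in \<open>auto intro!: derivative_eq_intros simp: gderiv_def\<close>)
  moreover have "(\<lambda>t. (t *\<^sub>R (y - x)) \<bullet> v) = (*) (v \<bullet> (y - x))" by (auto simp: inner_commute mult.commute)
  ultimately have "DERIV (\<lambda>t. f (?l t)) 0 :> v \<bullet> (y - x)" by (simp add: has_field_derivative_def)
  then have "((\<lambda>t. (f (?l t) - f x) / t) \<longlongrightarrow> v \<bullet> (y - x)) (at 0)" by (simp add: DERIV_def)
  then have lim: "((\<lambda>t. (f (?l t) - f x) / t) \<longlongrightarrow> v \<bullet> (y - x)) (at_right 0)"
    by (rule filterlim_mono) (auto simp: at_le)
  have "v \<bullet> (y - x) \<le> f y - f x - \<sigma> / 2 * (1 - 0) * (norm (x - y))\<^sup>2"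
  proof (rule tendsto_le[OF _ _ lim])
    show "((\<lambda>t. f y - f x - \<sigma> / 2 * (1 - t) * (norm (x - y))\<^sup>2) \<longlongrightarrow> f y - f x - \<sigma> / 2 * (1 - 0) * (norm (x - y))\<^sup>2) (at_right 0)"
      by (intro tendsto_intros)
    have "(f (?l t) - f x) / t \<le> f y - f x - \<sigma> / 2 * (1 - t) * (norm (x - y))\<^sup>2" if "0 < t" "t < 1" for t
    proof -
      have "?l t = (1 - t) *\<^sub>R x + t *\<^sub>R y" by (simp add: algebra_simps)
      then have "f (?l t) \<le> (1 - t) * f x + t * f y - \<sigma> / 2 * t * (1 - t) * (norm (x - y))\<^sup>2"
        using sc that by (auto simp: strongly_convex_def)
      then have "f (?l t) - f x \<le> (f y - f x - \<sigma> / 2 * (1 - t) * (norm (x - y))\<^sup>2) * t"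
        by (simp add: algebra_simps)
      then show ?thesis using that by (simp add: pos_divide_le_eq)
    qed
    then show "\<forall>\<^sub>F t in at_right 0. (f (?l t) - f x) / t \<le> f y - f x - \<sigma> / 2 * (1 - t) * (norm (x - y))\<^sup>2"
      unfolding eventually_at_right_field by (intro exI[of _ 1]) auto
  qed simp
  then show ?thesis by (simp add: norm_minus_commute)
qed

text \<open>The descent lemma. The function \<open>?\<phi>\<close> has nonpositive derivative by
  Cauchy--Schwarz and the Lipschitz estimate, and comparing its values at 1 and 0 avoids
  integration.\<close>

lemma lipschitz_gradient_upper_bound:
  assumes lip: "\<beta>-lipschitz_on UNIV f'" and f': "\<And>x. GDERIV f x :> f' x"
  shows "f y \<le> f x + f' x \<bullet> (y - x) + \<beta> / 2 * (norm (y - x))\<^sup>2"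
proof -
  let ?l = "\<lambda>t. x + t *\<^sub>R (y - x)"
  let ?\<phi> = "\<lambda>t. f (?l t) - t * (f' x \<bullet> (y - x)) - \<beta> / 2 * t\<^sup>2 * (norm (y - x))\<^sup>2"
  have "((\<lambda>t. f (?l t)) has_derivative (\<lambda>s. (s *\<^sub>R (y - x)) \<bullet> f' (?l t))) (at t)" for t
    by (rule has_derivative_compose[where f = ?l and f' = "\<lambda>t. t *\<^sub>R (y - x)"])
      (use f'[of "?l t"] in \<open>auto intro!: derivative_eq_intros simp: gderiv_def\<close>)
  moreover have "(\<lambda>s. (s *\<^sub>R (y - x)) \<bullet> f' (?l t)) = (*) (f' (?l t) \<bullet> (y - x))" for t
    by (auto simp: inner_commute mult.commute)
  ultimately have "DERIV (\<lambda>t. f (?l t)) t :> f' (?l t) \<bullet> (y - x)" for t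
    by (simp add: has_field_derivative_def)
  note [derivative_intros] = this
  have D: "DERIV ?\<phi> t :> f' (?l t) \<bullet> (y - x) - f' x \<bullet> (y - x) - \<beta> * t * (norm (y - x))\<^sup>2" for t
    by (auto intro!: derivative_eq_intros)
  have "?\<phi> 1 \<le> ?\<phi> 0"
  proof (rule DERIV_nonpos_imp_nonincreasing[where f = ?\<phi>])
    fix t :: real assume t: "0 \<le> t"
    have "f' (?l t) \<bullet> (y - x) - f' x \<bullet> (y - x) = (f' (?l t) - f' x) \<bullet> (y - x)"
      by (simp add: inner_diff_left)
    also have "\<dots> \<le> norm (f' (?l t) - f' x) * norm (y - x)" by (rule norm_cauchy_schwarz)
    also have "\<dots> \<le> (\<beta> * norm (?l t - x)) * norm (y - x)"
      using lipschitz_onD[OF lip, of "?l t" x] by (intro mult_right_mono) (auto simp: dist_norm)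
    also have "\<dots> = \<beta> * t * (norm (y - x))\<^sup>2" using t by (simp add: power2_eq_square)
    finally have "f' (?l t) \<bullet> (y - x) - f' x \<bullet> (y - x) - \<beta> * t * (norm (y - x))\<^sup>2 \<le> 0" by simp
    with D show "\<exists>d. DERIV ?\<phi> t :> d \<and> d \<le> 0" by blast
  qed simp
  then show ?thesis by simp
qed

text \<open>Baillon--Haddad: the tangent plane at \<open>x\<close> and the quadratic model at
  \<open>y\<close> enclose the value at a well chosen point. Swapping \<open>x\<close> and
  \<open>y\<close> and adding gives the claim.\<close>

lemma cocoercive_if_quadratic_bounds:
  fixes h :: "'a::real_inner \<Rightarrow> real"
  assumes L: "L > 0"
    and lo: "\<And>x z. h x + h' x \<bullet> (z - x) \<le> h z"
    and hi: "\<And>x z. h z \<le> h x + h' x \<bullet> (z - x) + L / 2 * (norm (z - x))\<^sup>2"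
  shows "(norm (h' x - h' y))\<^sup>2 \<le> L * ((h' x - h' y) \<bullet> (x - y))"
proof -
  have *: "h x + h' x \<bullet> (y - x) + 1 / (2 * L) * (norm (h' x - h' y))\<^sup>2 \<le> h y" for x y
  proof -
    define b where "b = h' x - h' y"
    \<comment> \<open>This \<open>z\<close> minimizes the quadratic upper model at \<open>y\<close>
      minus the linear functional given by \<open>h' x\<close>.\<close>
    define z where "z = y + (1 / L) *\<^sub>R b"
    have "h x + h' x \<bullet> (z - x) \<le> h y + h' y \<bullet> (z - y) + L / 2 * (norm (z - y))\<^sup>2"
      using lo[of x z] hi[of z y] by linarith
    moreover have "h' x \<bullet> (z - x) = h' x \<bullet> (y - x) + (1 / L) * (h' x \<bullet> b)"
      "h' y \<bullet> (z - y) = (1 / L) * (h' y \<bullet> b)"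
      by (simp_all add: z_def inner_add_right inner_diff_right)
    moreover have "L / 2 * (norm (z - y))\<^sup>2 = 1 / (2 * L) * (norm b)\<^sup>2"
      using L by (simp add: z_def power2_eq_square field_simps)
    moreover have "(norm b)\<^sup>2 = h' x \<bullet> b - h' y \<bullet> b"
      by (simp add: power2_norm_eq_inner inner_diff_left b_def)
    then have "(1 / L) * (norm b)\<^sup>2 = (1 / L) * (h' x \<bullet> b) - (1 / L) * (h' y \<bullet> b)"
      by (simp only: right_diff_distrib)
    moreover have "(1 / L) * (norm b)\<^sup>2 = 2 * (1 / (2 * L) * (norm b)\<^sup>2)" by simp
    ultimately show ?thesis unfolding b_def[symmetric] by linarith
  qed
  have "1 / L * (norm (h' x - h' y))\<^sup>2 \<le> (h' x - h' y) \<bullet> (x - y)"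
    using *[of x y] *[of y x] by (simp add: inner_diff_left inner_diff_right norm_minus_commute)
  then show ?thesis using L by (simp add: field_simps)
qed

text \<open>Subtracting \<open>\<sigma> / 2\<close> times the squared norm leaves a convex function
  with smoothness constant \<open>\<beta> - \<sigma>\<close>; its cocoercivity rearranges to this
  product.\<close>

lemma strongly_convex_lipschitz_gradient:
  fixes f :: "'a::real_inner \<Rightarrow> real"
  assumes sc: "strongly_convex \<sigma> f" and f': "\<And>x. GDERIV f x :> f' x"
    and lip: "\<beta>-lipschitz_on UNIV f'" and le: "\<sigma> \<le> \<beta>"
  shows "0 \<le> (f' x - f' y - \<sigma> *\<^sub>R (x - y)) \<bullet> (\<beta> *\<^sub>R (x - y) - (f' x - f' y))"
proof -
  let ?h = "\<lambda>x. f x - \<sigma> / 2 * (norm x)\<^sup>2" and ?h' = "\<lambda>x. f' x - \<sigma> *\<^sub>R x"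
  define c where "c = (?h' x - ?h' y) \<bullet> (x - y)"
  have sq: "(norm (z - x))\<^sup>2 = (norm z)\<^sup>2 - (norm x)\<^sup>2 - 2 * (x \<bullet> (z - x))" for x z :: 'a
    by (simp add: power2_norm_eq_inner inner_diff_left inner_diff_right inner_commute)
  \<comment> \<open>Cocoercivity divides by its constant and \<open>\<beta> = \<sigma>\<close> is
    allowed, hence the larger \<open>L\<close>; \<open>co1\<close> passes to the limit.\<close>
  have co: "(norm (?h' x - ?h' y))\<^sup>2 \<le> L * c" if L: "\<beta> - \<sigma> < L" for L
    unfolding c_def
  proof (rule cocoercive_if_quadratic_bounds[where h = ?h])
    show "0 < L" using L le by simp
    fix x z :: 'a
    have 1: "\<sigma> / 2 * (norm (z - x))\<^sup>2 = \<sigma> / 2 * (norm z)\<^sup>2 - \<sigma> / 2 * (norm x)\<^sup>2 - \<sigma> * (x \<bullet> (z - x))"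
      unfolding sq by (simp add: right_diff_distrib)
    have 2: "?h' x \<bullet> (z - x) = f' x \<bullet> (z - x) - \<sigma> * (x \<bullet> (z - x))"
      by (simp only: inner_diff_left inner_scaleR_left)
    have "(\<beta> - \<sigma>) / 2 * (norm (z - x))\<^sup>2 \<le> L / 2 * (norm (z - x))\<^sup>2"
      using L by (intro mult_right_mono) auto
    then have 3: "\<beta> / 2 * (norm (z - x))\<^sup>2 - \<sigma> / 2 * (norm (z - x))\<^sup>2 \<le> L / 2 * (norm (z - x))\<^sup>2"
      by (simp only: diff_divide_distrib left_diff_distrib)
    show "?h x + ?h' x \<bullet> (z - x) \<le> ?h z"
      using strongly_convex_lower_bound[OF sc f', of x z] unfolding 1 2 by argo
    show "?h z \<le> ?h x + ?h' x \<bullet> (z - x) + L / 2 * (norm (z - x))\<^sup>2"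
      using lipschitz_gradient_upper_bound[OF lip f', of z x] 3 unfolding 1 2 by argo
  qed
  have co1: "(norm (?h' x - ?h' y))\<^sup>2 \<le> (\<beta> - \<sigma>) * c"
  proof (rule tendsto_lowerbound)
    show "((\<lambda>L. L * c) \<longlongrightarrow> (\<beta> - \<sigma>) * c) (at_right (\<beta> - \<sigma>))" by (intro tendsto_intros)
    show "\<forall>\<^sub>F L in at_right (\<beta> - \<sigma>). (norm (?h' x - ?h' y))\<^sup>2 \<le> L * c"
      using eventually_at_right_less by eventually_elim (rule co)
  qed simp
  define b where "b = f' x - f' y - \<sigma> *\<^sub>R (x - y)"
  have b1: "?h' x - ?h' y = b" by (simp add: b_def algebra_simps)
  have b2: "\<beta> *\<^sub>R (x - y) - (f' x - f' y) = (\<beta> - \<sigma>) *\<^sub>R (x - y) - b"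
    by (simp add: b_def algebra_simps)
  have "b \<bullet> b \<le> (\<beta> - \<sigma>) * (b \<bullet> (x - y))"
    using co1 unfolding c_def b1 power2_norm_eq_inner .
  then have "0 \<le> b \<bullet> ((\<beta> - \<sigma>) *\<^sub>R (x - y) - b)"
    by (simp only: inner_diff_right[of b _ b] inner_scaleR_right diff_ge_0_iff_ge)
  then show ?thesis unfolding b2 unfolding b_def .
qed

text \<open>Here \<open>a\<close> stands for a difference of prox points and \<open>b\<close> for
  the matching difference of gradients, so \<open>a + \<gamma> *\<^sub>R b\<close> is the difference
  of the arguments and \<open>a - \<gamma> *\<^sub>R b\<close> that of the reflected points.\<close>

lemma reflected_resolvent_contraction:
  fixes a b :: "'a::real_inner"
  assumes g: "\<gamma> > 0" and \<sigma>: "0 < \<sigma>" "\<sigma> \<le> \<beta>"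
    and ab: "0 \<le> (b - \<sigma> *\<^sub>R a) \<bullet> (\<beta> *\<^sub>R a - b)"
  shows "norm (a - \<gamma> *\<^sub>R b)
    \<le> max ((\<gamma> * \<beta> - 1) / (\<gamma> * \<beta> + 1)) ((1 - \<gamma> * \<sigma>) / (1 + \<gamma> * \<sigma>)) * norm (a + \<gamma> *\<^sub>R b)"
proof -
  \<comment> \<open>The two entries of the maximum, for which \<open>c *\<^sub>R s - r\<close> and
    \<open>d *\<^sub>R s + r\<close> are positive multiples of the two factors in
    \<open>ab\<close>.\<close>
  define c d where "c = (1 - \<gamma> * \<sigma>) / (1 + \<gamma> * \<sigma>)" and "d = (\<gamma> * \<beta> - 1) / (\<gamma> * \<beta> + 1)"
  define s r where "s = a + \<gamma> *\<^sub>R b" and "r = a - \<gamma> *\<^sub>R b"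
  have pos: "\<gamma> * \<sigma> > 0" "\<gamma> * \<beta> > 0" using g \<sigma> by auto
  have le: "\<gamma> * \<sigma> \<le> \<gamma> * \<beta>" using g \<sigma> by simp
  have cd: "c + d \<ge> 0"
  proof -
    have "c + d = 2 / (1 + \<gamma> * \<sigma>) - 2 / (1 + \<gamma> * \<beta>)"
      unfolding c_def d_def using pos by (simp add: field_simps)
    moreover have "2 / (1 + \<gamma> * \<beta>) \<le> 2 / (1 + \<gamma> * \<sigma>)" using pos le by (intro divide_left_mono) auto
    ultimately show ?thesis by simp
  qed
  have 1: "c *\<^sub>R s - r = (2 * \<gamma> / (1 + \<gamma> * \<sigma>)) *\<^sub>R (b - \<sigma> *\<^sub>R a)"
  proof -
    have "c - 1 = - (2 * \<gamma> / (1 + \<gamma> * \<sigma>)) * \<sigma>" "\<gamma> * c + \<gamma> = 2 * \<gamma> / (1 + \<gamma> * \<sigma>)"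
      using pos by (simp_all add: c_def divide_simps) (simp_all add: algebra_simps)
    moreover have "c *\<^sub>R s - r = (c - 1) *\<^sub>R a + (\<gamma> * c + \<gamma>) *\<^sub>R b"
      by (simp add: s_def r_def algebra_simps)
    ultimately show ?thesis by (simp add: scaleR_diff_right)
  qed
  have 2: "d *\<^sub>R s + r = (2 * \<gamma> / (\<gamma> * \<beta> + 1)) *\<^sub>R (\<beta> *\<^sub>R a - b)"
  proof -
    have "d + 1 = 2 * \<gamma> / (\<gamma> * \<beta> + 1) * \<beta>" "\<gamma> * d - \<gamma> = - (2 * \<gamma> / (\<gamma> * \<beta> + 1))"
      using pos by (simp_all add: d_def divide_simps) (simp_all add: algebra_simps)
    moreover have "d *\<^sub>R s + r = (d + 1) *\<^sub>R a + (\<gamma> * d - \<gamma>) *\<^sub>R b"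
      by (simp add: s_def r_def algebra_simps)
    ultimately show ?thesis by (simp add: scaleR_diff_right)
  qed
  have "0 \<le> (2 * \<gamma> / (1 + \<gamma> * \<sigma>)) * ((2 * \<gamma> / (\<gamma> * \<beta> + 1)) * ((b - \<sigma> *\<^sub>R a) \<bullet> (\<beta> *\<^sub>R a - b)))"
    using pos g ab by simp
  then have nn: "0 \<le> (c *\<^sub>R s - r) \<bullet> (d *\<^sub>R s + r)" unfolding 1 2 by (simp add: mult_ac)
  \<comment> \<open>By Thales, r lies in the ball having the segment from c s to - d s as a diameter.\<close>
  have "(norm (r - m *\<^sub>R s))\<^sup>2 = r \<bullet> r - 2 * m * (r \<bullet> s) + m\<^sup>2 * (s \<bullet> s)" for m
    unfolding power2_norm_eq_inner power2_eq_square[of m] inner_diff_left inner_diff_right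
      inner_scaleR_left inner_scaleR_right inner_commute[of s r] right_diff_distrib by simp
  from this[of "(c - d) / 2"] have "(norm (r - ((c - d) / 2) *\<^sub>R s))\<^sup>2
      = r \<bullet> r - (c - d) * (r \<bullet> s) + ((c - d) / 2)\<^sup>2 * (s \<bullet> s)" by simp
  moreover have "(c *\<^sub>R s - r) \<bullet> (d *\<^sub>R s + r) = c * d * (s \<bullet> s) + (c - d) * (r \<bullet> s) - r \<bullet> r"
    by (simp add: inner_diff_left inner_add_right inner_commute[of s r] left_diff_distrib right_diff_distrib)
  moreover have "((c + d) / 2)\<^sup>2 = ((c - d) / 2)\<^sup>2 + c * d"
    by (simp add: power2_eq_square field_simps)
  then have "((c + d) / 2 * norm s)\<^sup>2 = ((c - d) / 2)\<^sup>2 * (s \<bullet> s) + c * d * (s \<bullet> s)"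
    by (simp only: power_mult_distrib power2_norm_eq_inner distrib_right)
  ultimately have "(norm (r - ((c - d) / 2) *\<^sub>R s))\<^sup>2
      = ((c + d) / 2 * norm s)\<^sup>2 - (c *\<^sub>R s - r) \<bullet> (d *\<^sub>R s + r)"
    by linarith
  then have "(norm (r - ((c - d) / 2) *\<^sub>R s))\<^sup>2 \<le> ((c + d) / 2 * norm s)\<^sup>2"
    using nn by linarith
  then have "norm (r - ((c - d) / 2) *\<^sub>R s) \<le> (c + d) / 2 * norm s"
    by (rule power2_le_imp_le) (use cd in simp)
  moreover have "norm r \<le> norm (r - ((c - d) / 2) *\<^sub>R s) + norm (((c - d) / 2) *\<^sub>R s)"
    by (metis add_diff_cancel_left' diff_add_cancel norm_triangle_ineq)
  \<comment> \<open>Centre plus radius; the two halves add up to the larger of \<open>c\<close> and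
    \<open>d\<close>.\<close>
  ultimately have "norm r \<le> ((c + d) / 2 + \<bar>c - d\<bar> / 2) * norm s"
    unfolding distrib_right norm_scaleR by simp
  also have "(c + d) / 2 + \<bar>c - d\<bar> / 2 = max d c" by (simp add: max_def abs_if field_simps)
  finally show ?thesis by (simp add: s_def r_def c_def d_def)
qed

section \<open>Differentiability of the prox along a subspace\<close>

text \<open>The projection enters through its image and its orthogonal residual, which keeps later
  arguments free of a chosen basis.\<close>

locale orthogonal_projection =
  fixes V :: "'a::euclidean_space set" and P :: "'a \<Rightarrow> 'a"
  assumes subspace: "subspace V" and linear: "linear P" and mem: "P x \<in> V"
    and orth: "v \<in> V \<Longrightarrow> (x - P x) \<bullet> v = 0"
begin

lemma fixed: "v \<in> V \<Longrightarrow> P v = v"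
proof -
  assume "v \<in> V"
  then have "v - P v \<in> V" using mem subspace by (intro subspace_diff)
  then have "(v - P v) \<bullet> (v - P v) = 0" by (rule orth)
  then show ?thesis by simp
qed

lemma inner_eq: "v \<in> V \<Longrightarrow> P x \<bullet> v = x \<bullet> v"
  using orth[of v x] by (simp add: inner_diff_left)

lemma norm_le: "norm (P x) \<le> norm x"
proof -
  have "(norm (P x))\<^sup>2 = x \<bullet> P x" using inner_eq[OF mem, of x x] by (simp add: power2_norm_eq_inner)
  also have "\<dots> \<le> norm x * norm (P x)" by (rule norm_cauchy_schwarz)
  finally show ?thesis by (cases "P x = 0") (auto simp: power2_eq_square)
qed

lemma bounded_linear: "bounded_linear P"
  using linear by (simp add: linear_conv_bounded_linear)

lemma idem: "P (P x) = P x" by (rule fixed[OF mem])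

lemmas diff = linear_diff[OF linear] and scale = linear_scale[OF linear]
  and add = linear_add[OF linear] and zero = linear_0[OF linear]

end

text \<open>Fourier sum over an orthonormal basis of \<open>V\<close>; orthogonality of the residual
  to the basis passes to its span.\<close>

lemma orthogonal_projection_exists:
  fixes V :: "'a::euclidean_space set"
  assumes V: "subspace V"
  obtains P where "orthogonal_projection V P"
proof -
  obtain B where B: "B \<subseteq> V" "pairwise orthogonal B" "\<And>x. x \<in> B \<Longrightarrow> norm x = 1" "independent B"
      "span B = V"
    using orthonormal_basis_subspace[OF V] by metis
  have fin: "finite B" using B(4) by (rule independent_imp_finite)
  let ?P = "\<lambda>x. \<Sum>b\<in>B. (x \<bullet> b) *\<^sub>R b"
  show thesis
  proof (rule that, rule orthogonal_projection.intro[OF V])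
    show "linear ?P"
      by (intro linearI) (simp_all add: inner_add_left scaleR_add_left sum.distrib scaleR_sum_right)
    show "?P x \<in> V" for x using B(1) V by (intro subspace_sum) (auto intro: subspace_scale)
    fix x v assume v: "v \<in> V"
    have "(x - ?P x) \<bullet> b = 0" if b: "b \<in> B" for b
    proof -
      have "?P x \<bullet> b = (\<Sum>c\<in>B. (x \<bullet> c) * (c \<bullet> b))" by (simp add: inner_sum_left)
      also have "\<dots> = (\<Sum>c\<in>B. if c = b then x \<bullet> b else 0)"
      proof (rule sum.cong[OF refl])
        fix c assume "c \<in> B"
        then show "(x \<bullet> c) * (c \<bullet> b) = (if c = b then x \<bullet> b else 0)"
          using b B(2) B(3)[of b] by (auto simp: pairwise_def orthogonal_def norm_eq_1)
      qed
      also have "\<dots> = x \<bullet> b" using b fin by simp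
      finally show ?thesis by (simp add: inner_diff_left)
    qed
    then have "orthogonal (x - ?P x) v"
      using v B(5) orthogonal_to_span[of v B "x - ?P x"] by (auto simp: orthogonal_def)
    then show "(x - ?P x) \<bullet> v = 0" by (simp add: orthogonal_def)
  qed
qed

text \<open>Difference quotients of \<open>k\<close> along a line through \<open>p\<close>, paired
  with the direction, are nonnegative, hence so is their limit.\<close>

lemma has_derivative_inner_nonneg:
  fixes k :: "'a::real_inner \<Rightarrow> 'a"
  assumes D: "(k has_derivative D) (at p)" and U: "open U" "p \<in> U"
    and mono: "\<And>x. x \<in> U \<Longrightarrow> 0 \<le> (k x - k p) \<bullet> (x - p)"
  shows "0 \<le> D v \<bullet> v"
proof -
  obtain e where e: "e > 0" "ball p e \<subseteq> U" using U open_contains_ball by blast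
  have "((\<lambda>t. k (p + t *\<^sub>R v)) has_derivative (\<lambda>t. D (t *\<^sub>R v))) (at 0)"
    by (rule has_derivative_compose[where f = "\<lambda>t. p + t *\<^sub>R v" and f' = "\<lambda>t. t *\<^sub>R v"])
      (use D in \<open>auto intro!: derivative_eq_intros\<close>)
  then have "((\<lambda>t. k (p + t *\<^sub>R v) \<bullet> v) has_derivative (\<lambda>t. D (t *\<^sub>R v) \<bullet> v)) (at 0)"
    by (rule has_derivative_inner_left)
  moreover have "(\<lambda>t. D (t *\<^sub>R v) \<bullet> v) = (*) (D v \<bullet> v)"
    using linear_scale[OF has_derivative_linear[OF D]] by (auto simp: mult.commute)
  ultimately have "DERIV (\<lambda>t. k (p + t *\<^sub>R v) \<bullet> v) 0 :> D v \<bullet> v"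
    by (simp add: has_field_derivative_def)
  then have "((\<lambda>t. (k (p + t *\<^sub>R v) \<bullet> v - k p \<bullet> v) / t) \<longlongrightarrow> D v \<bullet> v) (at 0)"
    by (simp add: DERIV_def)
  then have lim: "((\<lambda>t. (k (p + t *\<^sub>R v) \<bullet> v - k p \<bullet> v) / t) \<longlongrightarrow> D v \<bullet> v) (at_right 0)"
    by (rule filterlim_mono) (auto simp: at_le)
  have "((\<lambda>t. norm (t *\<^sub>R v)) \<longlongrightarrow> norm (0 *\<^sub>R v)) (at_right 0)" by (intro tendsto_intros)
  then have "\<forall>\<^sub>F t in at_right 0. norm (t *\<^sub>R v) < e" by (rule order_tendstoD) (use e in simp)
  then have "\<forall>\<^sub>F t in at_right 0. 0 \<le> (k (p + t *\<^sub>R v) \<bullet> v - k p \<bullet> v) / t"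
    using eventually_at_right_less[of 0]
  proof eventually_elim
    case (elim t)
    then have "p + t *\<^sub>R v \<in> U" using e by (auto simp: dist_norm)
    from mono[OF this] have "0 \<le> t * (k (p + t *\<^sub>R v) \<bullet> v - k p \<bullet> v)" by (simp add: inner_diff_left)
    then show ?case using elim by (simp add: zero_le_mult_iff)
  qed
  then show ?thesis using tendsto_lowerbound[OF lim] by simp
qed

text \<open>Pairing the image of \<open>v\<close> with \<open>v\<close> gives at least
  \<open>v \<bullet> v\<close>, so the kernel is trivial; finite dimension does the rest.\<close>

lemma bij_id_plus_monotone:
  fixes D :: "'a::euclidean_space \<Rightarrow> 'a"
  assumes "linear D" and "\<And>v. 0 \<le> D v \<bullet> v" and "\<gamma> > 0"
  shows "linear (\<lambda>v. v + \<gamma> *\<^sub>R D v)" and "bij (\<lambda>v. v + \<gamma> *\<^sub>R D v)"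
proof -
  let ?G = "\<lambda>v. v + \<gamma> *\<^sub>R D v"
  show lin: "linear ?G" using assms(1)
    by (intro linearI) (simp_all add: linear_add linear_scale algebra_simps)
  have "v = 0" if "?G v = 0" for v
  proof -
    have "?G v \<bullet> v = v \<bullet> v + \<gamma> * (D v \<bullet> v)" by (simp add: inner_add_left)
    moreover have "0 \<le> \<gamma> * (D v \<bullet> v)" using assms by simp
    ultimately have "v \<bullet> v \<le> 0" using that by simp
    then show ?thesis using inner_eq_zero_iff inner_ge_zero order_antisym by blast
  qed
  then have "inj ?G" unfolding linear_injective_0[OF lin] by blast
  then show "bij ?G" using linear_injective_imp_surjective[OF lin] by (simp add: bij_def)
qed

text \<open>The prox near \<open>w\<close> is obtained by solving \<open>x + \<gamma> k(x) = p + P(w - p)\<close>,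
  whose left side is an expanding, hence locally invertible, map.\<close>

lemma prox_differentiable_if_tangential_subgradients:
  fixes g :: "'a::euclidean_space \<Rightarrow> ereal" and k :: "'a \<Rightarrow> 'a"
  assumes g: "proper_closed_convex g" and \<gamma>: "\<gamma> > 0"
    and P: "orthogonal_projection V P"
    and r: "r > 0"
    and cont: "continuous_on (ball p r) k"
    and D: "(k has_derivative D) (at p)"
    and k: "\<And>x. k x = k (p + P (x - p))" "\<And>x. k x \<in> V"
    and v0: "P v0 = k p" and w: "w = p + \<gamma> *\<^sub>R v0"
    and sub: "\<And>x v. \<lbrakk>x \<in> ball p r; x - p \<in> V; dist v v0 < r; P v = k x\<rbrakk> \<Longrightarrow> v \<in> subdifferential g x"
  shows "prox \<gamma> g differentiable (at w)"
proof -
  interpret orthogonal_projection V P by (rule P)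
  have "isCont k p" using D has_derivative_continuous by blast
  then have "\<forall>\<^sub>F x in nhds p. dist (k x) (k p) < r"
    unfolding isCont_def tendsto_at_iff_tendsto_nhds by (rule tendstoD) (rule r)
  then obtain s where s: "s > 0" "\<And>x. dist x p < s \<Longrightarrow> dist (k x) (k p) < r"
    by (auto simp: eventually_nhds_metric)
  \<comment> \<open>The radius \<open>s\<close> keeps \<open>v0 + (k x - k p)\<close> within
    \<open>r\<close> of \<open>v0\<close>, as \<open>sub\<close> demands, and a ball around
    \<open>p\<close> is stable under projection onto \<open>p + V\<close>.\<close>
  define U where "U = ball p (min r s)"
  have U: "open U" "p \<in> U" "U \<subseteq> ball p r" using r s by (auto simp: U_def)
  have PU: "p + P (x - p) \<in> U" if "x \<in> U" for x
    using that norm_le[of "x - p"] by (auto simp: U_def dist_norm norm_minus_commute)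
  \<comment> \<open>The difference \<open>k x - k y\<close> is one of subgradients at the projected
    points, so monotonicity comes from the subdifferential. Both values lie in \<open>V\<close>,
    which lets the projection be dropped from the other factor.\<close>
  have mono: "0 \<le> (k x - k y) \<bullet> (x - y)" if xy: "x \<in> U" "y \<in> U" for x y
  proof -
    have *: "v0 + (k x - k p) \<in> subdifferential g (p + P (x - p))" if "x \<in> U" for x
    proof (rule sub)
      show "p + P (x - p) \<in> ball p r" using PU[OF that] U by auto
      show "p + P (x - p) - p \<in> V" using mem by simp
      show "dist (v0 + (k x - k p)) v0 < r"
        using s(2)[of x] that by (simp add: U_def dist_commute[of p x] dist_norm[of "_ + _"] dist_norm[of "k x"])
      show "P (v0 + (k x - k p)) = k (p + P (x - p))"
        using k(1)[of x] by (simp add: add diff v0 fixed[OF k(2)])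
    qed
    have "0 \<le> (v0 + (k x - k p) - (v0 + (k y - k p))) \<bullet> (p + P (x - p) - (p + P (y - p)))"
      by (intro subdifferential_monotone[OF g] * xy)
    also have "\<dots> = P (x - y) \<bullet> (k x - k y)" by (simp add: diff inner_commute)
    also have "\<dots> = (x - y) \<bullet> (k x - k y)" by (intro inner_eq subspace_diff[OF subspace] k)
    finally show ?thesis by (simp add: inner_commute)
  qed
  define F where "F x = x + \<gamma> *\<^sub>R k x" for x
  \<comment> \<open>Paired with \<open>x - y\<close>, the monotone part only adds. Expansion gives
    injectivity now and a 1-Lipschitz inverse later.\<close>
  have expand: "norm (x - y) \<le> norm (F x - F y)" if xy: "x \<in> U" "y \<in> U" for x y
  proof -
    have "(norm (x - y))\<^sup>2 \<le> (norm (x - y))\<^sup>2 + \<gamma> * ((k x - k y) \<bullet> (x - y))"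
      using mono[OF xy] \<gamma> by simp
    also have "\<dots> = (F x - F y) \<bullet> (x - y)"
      by (simp add: F_def power2_norm_eq_inner algebra_simps)
    also have "\<dots> \<le> norm (F x - F y) * norm (x - y)" by (rule norm_cauchy_schwarz)
    finally show ?thesis by (cases "x = y") (auto simp: power2_eq_square)
  qed
  have inj: "inj_on F U"
  proof (rule inj_onI)
    fix x y assume "x \<in> U" "y \<in> U" "F x = F y"
    then show "x = y" using expand[of x y] by simp
  qed
  have "continuous_on U F" unfolding F_def
    by (intro continuous_intros continuous_on_subset[OF cont] U)
  \<comment> \<open>Since \<open>k\<close> is assumed differentiable at \<open>p\<close> only and
    continuous nearby, invariance of domain takes the place of the inverse function theorem.\<close>
  then have open_F: "open (F ` U)" using inj U(1) by (intro invariance_of_domain)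
  define H where "H = inv_into U F"
  have HF: "H (F x) = x" if "x \<in> U" for x using that inj by (simp add: H_def)
  have FH: "F (H y) = y" "H y \<in> U" if "y \<in> F ` U" for y
    using that by (simp_all add: H_def f_inv_into_f inv_into_into)
  have contH: "isCont H y" if "y \<in> F ` U" for y
  proof -
    have "dist (H x) (H z) \<le> dist x z" if "x \<in> F ` U" "z \<in> F ` U" for x z
      using expand[of "H x" "H z"] FH that by (simp add: dist_norm)
    then have "continuous_on (F ` U) H" by (intro continuous_on_iff[THEN iffD2]) (meson le_less_trans)
    then show ?thesis using that open_F continuous_on_eq_continuous_at by blast
  qed
  let ?G = "\<lambda>v. v + \<gamma> *\<^sub>R D v"
  have Dpos: "0 \<le> D v \<bullet> v" for v using mono U by (intro has_derivative_inner_nonneg[OF D U(1,2)]) auto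
  note G = bij_id_plus_monotone[OF has_derivative_linear[OF D] Dpos \<gamma>]
  have Fp: "F p \<in> F ` U" using U by blast
  have dH: "(H has_derivative inv ?G) (at (F p))"
  proof (rule has_derivative_inverse_basic_x[where f = F and f' = ?G and T = "F ` U"])
    show "(F has_derivative ?G) (at p)" unfolding F_def by (intro derivative_intros D)
    show "bounded_linear (inv ?G)"
      using G by (simp add: bij_is_inj bij_is_surj inj_linear_imp_inv_linear linear_conv_bounded_linear[symmetric])
    show "inv ?G \<circ> ?G = id" using G by (simp add: bij_is_inj)
  qed (use contH[OF Fp] HF U open_F Fp FH in auto)
  \<comment> \<open>Only the tangential part of \<open>w' - p\<close> enters the equation for the
    prox point; the normal part ends up in \<open>Q w'\<close>.\<close>
  define N where "N w' = p + P (w' - p)" for w'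
  have Nw: "N w = F p" by (simp add: N_def F_def w scale v0)
  have dN: "(N has_derivative P) (at w)" unfolding N_def
    by (auto intro!: derivative_eq_intros bounded_linear.has_derivative[OF bounded_linear])
  have dHN: "((\<lambda>w'. H (N w')) has_derivative (\<lambda>v. inv ?G (P v))) (at w)"
    by (rule has_derivative_compose[OF dN]) (simp add: Nw dH)
  have contHN: "isCont (\<lambda>w'. H (N w')) w" using dHN has_derivative_continuous by blast
  \<comment> \<open>The subgradient that must occur if \<open>H (N w')\<close> is the prox point. It
    equals \<open>v0\<close> at \<open>w\<close>, so continuity keeps it in the range where
    \<open>sub\<close> applies.\<close>
  define Q where "Q w' = (1/\<gamma>) *\<^sub>R (w' - H (N w'))" for w'
  have Qw: "Q w = v0" using \<gamma> U by (simp add: Q_def Nw HF) (simp add: w)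
  have "isCont N w" using dN has_derivative_continuous by blast
  then have "\<forall>\<^sub>F w' in nhds w. N w' \<in> F ` U"
    unfolding isCont_def tendsto_at_iff_tendsto_nhds
    by (rule topological_tendstoD[OF _ open_F]) (simp add: Nw Fp)
  moreover have "isCont Q w" unfolding Q_def using contHN by (intro continuous_intros)
  then have "\<forall>\<^sub>F w' in nhds w. dist (Q w') v0 < r"
    unfolding isCont_def tendsto_at_iff_tendsto_nhds unfolding Qw by (rule tendstoD) (rule r)
  ultimately have "\<forall>\<^sub>F w' in nhds w. prox \<gamma> g w' = H (N w')"
  proof eventually_elim
    case (elim w')
    let ?x = "H (N w')"
    have x: "?x \<in> U" "F ?x = N w'" using FH elim by auto
    have "?x - p = P (w' - p) - \<gamma> *\<^sub>R k ?x" using x(2) by (simp add: N_def F_def algebra_simps)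
    then have xV: "?x - p \<in> V" using mem k subspace by (simp add: subspace_diff subspace_scale)
    have "P (w' - ?x) = P (w' - p) - P (?x - p)" by (simp flip: diff)
    also have "P (?x - p) = P (w' - p) - \<gamma> *\<^sub>R k ?x"
      unfolding fixed[OF xV] using x(2) by (simp add: N_def F_def algebra_simps)
    finally have "P (Q w') = k ?x" using \<gamma> by (simp add: Q_def scale)
    then have "Q w' \<in> subdifferential g ?x"
      using x U elim xV by (intro sub) auto
    then show ?case unfolding Q_def by (rule prox_eqI[OF g \<gamma>])
  qed
  then have "\<forall>\<^sub>F w' in nhds w. H (N w') = prox \<gamma> g w'" by (rule eventually_mono) simp
  then have "(prox \<gamma> g has_derivative (\<lambda>v. inv ?G (P v))) (at w)"
    by (intro has_derivative_transform_eventually[OF dHN])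
      (auto simp: eventually_at_filter elim: eventually_mono dest: eventually_nhds_x_imp_x)
  then show ?thesis by (auto simp: differentiable_def)
qed

section \<open>Partly smooth functions\<close>

lemma subdifferential_closed_convex:
  fixes h :: "'a::real_inner \<Rightarrow> ereal"
  assumes "\<bar>h x\<bar> \<noteq> \<infinity>"
  shows "closed (subdifferential h x)" and "convex (subdifferential h x)"
proof -
  obtain a where a: "h x = ereal a" using assms by (metis ereal_real')
  \<comment> \<open>The subdifferential is the intersection of these sets over \<open>y\<close>; for
    finite \<open>h y\<close> each is given by one linear inequality, otherwise it is the whole
    space or empty.\<close>
  define C where "C y = {v. h x + ereal (v \<bullet> (y - x)) \<le> h y}" for y
  have C: "closed (C y) \<and> convex (C y)" for y
  proof (cases "h y")
    case (real b)
    then have "C y = {v. (y - x) \<bullet> v \<le> b - a}" by (auto simp: C_def a inner_commute)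
    then show ?thesis by (simp add: closed_halfspace_le convex_halfspace_le)
  qed (simp_all add: C_def a)
  have "subdifferential h x = (\<Inter>y. C y)" by (auto simp: subdifferential_def C_def)
  then show "closed (subdifferential h x)" and "convex (subdifferential h x)"
    using C by (auto intro!: closed_INT convex_INT)
qed

context orthogonal_projection
begin

lemma eqI: "(\<And>d. d \<in> V \<Longrightarrow> a \<bullet> d = b \<bullet> d) \<Longrightarrow> P a = P b"
proof -
  assume "\<And>d. d \<in> V \<Longrightarrow> a \<bullet> d = b \<bullet> d"
  then have "P (a - b) \<bullet> P (a - b) = 0"
    using inner_eq[OF mem, of "a - b" "a - b"] mem by (simp add: inner_diff_left)
  then show ?thesis by (simp add: diff)
qed

lemma compl_mem: "x - P x \<in> V\<^sup>\<bottom>"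
  using orth by (simp add: orthogonal_comp_def orthogonal_def inner_commute)

lemma zero_inner: "P x = 0 \<Longrightarrow> v \<in> V \<Longrightarrow> x \<bullet> v = 0"
  using inner_eq[of v x] by simp

end

text \<open>If some \<open>v\<close> close to \<open>v0\<close> with the right tangential part were not a subgradient at \<open>x\<close>,
  a separating direction would be normal to \<open>V\<close>; but \<open>\<partial>g(x)\<close> nearly contains a whole ball
  around \<open>v0\<close> in the normal space.\<close>

lemma compact_imp_finite_net:
  fixes K :: "'a::metric_space set"
  assumes "compact K" "e > 0"
  obtains N where "finite N" "N \<subseteq> K" "K \<subseteq> (\<Union>c\<in>N. ball c e)"
  by (rule compactE_image[OF assms(1), of K "\<lambda>c. ball c e"]) (use assms(2) in auto)

lemma prox_differentiable_if_partly_smooth: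
  fixes g :: "'a::euclidean_space \<Rightarrow> ereal"
  assumes g: "proper_closed_convex g" and \<gamma>: "\<gamma> > 0"
    and M: "locally_affine_manifold M p V" and ps: "partly_smooth g p M V"
    and v0: "v0 \<in> rel_interior (subdifferential g p)" and w: "w = p + \<gamma> *\<^sub>R v0"
  shows "prox \<gamma> g differentiable (at w)"
proof -
  have V: "subspace V" using M by (simp add: locally_affine_manifold_def)
  obtain P where "orthogonal_projection V P" using orthogonal_projection_exists[OF V] .
  then interpret orthogonal_projection V P .
  have "\<exists>U. open U \<and> p \<in> U \<and> M \<inter> U = ((+) p ` V) \<inter> U"
    using M unfolding locally_affine_manifold_def by (rule conjunct2)
  then obtain U1 where U1: "open U1" "p \<in> U1" "M \<inter> U1 = ((+) p ` V) \<inter> U1"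
    by (elim exE conjE) (rule that)
  have "C2_near M p g" using ps by (simp add: partly_smooth_def)
  then obtain U2 where U2: "open U2" "p \<in> U2" "\<And>x. x \<in> M \<inter> U2 \<Longrightarrow> \<bar>g x\<bar> \<noteq> \<infinity>"
    and C2: "C2_on (M \<inter> U2) (\<lambda>x. real_of_ereal (g x))"
    unfolding C2_near_def by (elim exE conjE) (rule that, simp_all)
  obtain r0 where r0: "r0 > 0" "ball p r0 \<subseteq> U1 \<inter> U2"
    using openE[OF open_Int[OF U1(1) U2(1)], of p] U1(2) U2(2) by blast
  \<comment> \<open>The flat piece of \<open>M\<close> on which both the affine description and the
    derivatives are available.\<close>
  define S where "S = {x \<in> ball p r0. x - p \<in> V}"
  have SM: "S \<subseteq> M \<inter> U2"
  proof
    fix x assume x: "x \<in> S"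
    then have "x = p + (x - p)" "x - p \<in> V" "x \<in> U1" "x \<in> U2" using r0 by (auto simp: S_def)
    then show "x \<in> M \<inter> U2" using U1(3) by blast
  qed
  obtain D1 :: "'a \<Rightarrow> 'a \<Rightarrow>\<^sub>L real" and D2 :: "'a \<Rightarrow> 'a \<Rightarrow>\<^sub>L ('a \<Rightarrow>\<^sub>L real)"
    where D1': "\<And>x. x \<in> M \<inter> U2 \<Longrightarrow>
        ((\<lambda>x. real_of_ereal (g x)) has_derivative blinfun_apply (D1 x)) (at x within M \<inter> U2)"
      and D2': "\<And>x. x \<in> M \<inter> U2 \<Longrightarrow> (D1 has_derivative blinfun_apply (D2 x)) (at x within M \<inter> U2)"
    using C2 unfolding C2_on_def by blast
  have D1: "((\<lambda>x. real_of_ereal (g x)) has_derivative blinfun_apply (D1 x)) (at x within S)"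
    and D2: "(D1 has_derivative blinfun_apply (D2 x)) (at x within S)" if "x \<in> S" for x
    using D1'[of x] D2'[of x] that SM by (auto intro: has_derivative_subset)
  \<comment> \<open>Riesz vector of \<open>D1 x\<close>. Derivatives within \<open>S\<close> are
    determined only along \<open>V\<close>, so only \<open>P (h x)\<close> is intrinsic.\<close>
  define h where "h x = (\<Sum>b\<in>Basis. D1 x b *\<^sub>R b)" for x
  have h: "D1 x d = h x \<bullet> d" for x d
    using linear_eq_inner_sum_Basis[OF bounded_linear.linear[OF blinfun.bounded_linear_right], of "D1 x" d]
    unfolding h_def by (simp only: inner_commute)
  \<comment> \<open>Every subgradient agrees with the derivative along \<open>V\<close>. The step
    bound has \<open>norm d + 1\<close> as denominator to include \<open>d = 0\<close>.\<close>
  have tangential: "P v = P (h x)" if x: "x \<in> S" and v: "v \<in> subdifferential g x" for x v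
  proof (rule eqI)
    fix d assume d: "d \<in> V"
    have "open (ball p r0)" "x \<in> ball p r0" using x by (auto simp: S_def)
    then obtain e where e: "e > 0" "ball x e \<subseteq> ball p r0" using open_contains_ball by blast
    have "D1 x d = v \<bullet> d"
    proof (rule subgradient_eq_derivative[OF v D1[OF x]])
      show "\<bar>g y\<bar> \<noteq> \<infinity>" if "y \<in> S" for y by (rule U2(3)[OF subsetD[OF SM that]])
      show "e / (norm d + 1) > 0" using e(1) by (intro divide_pos_pos add_nonneg_pos) auto
      fix t :: real assume "\<bar>t\<bar> < e / (norm d + 1)"
      then have "\<bar>t\<bar> * (norm d + 1) < e" by (simp add: pos_less_divide_eq add_nonneg_pos)
      moreover have "\<bar>t\<bar> * norm d \<le> \<bar>t\<bar> * (norm d + 1)" by (intro mult_left_mono) auto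
      ultimately have "x + t *\<^sub>R d \<in> ball x e" by (simp add: dist_norm)
      moreover have "(x - p) + t *\<^sub>R d \<in> V"
        using x d by (intro subspace_add[OF V] subspace_scale[OF V]) (simp_all add: S_def)
      then have "x + t *\<^sub>R d - p \<in> V" by (simp add: algebra_simps)
      ultimately show "x + t *\<^sub>R d \<in> S" using e(2) by (auto simp: S_def)
    qed
    then show "v \<bullet> d = h x \<bullet> d" by (simp add: h)
  qed
  \<comment> \<open>Retraction onto \<open>p + V\<close>, by which derivatives known only within
    \<open>S\<close> yield a map \<open>k\<close> on a full ball.\<close>
  define l where "l x = p + P (x - p)" for x
  have lS: "l x \<in> S" if "x \<in> ball p r0" for x
    using that norm_le[of "x - p"] mem by (auto simp: l_def S_def dist_norm norm_minus_commute)
  have ll: "p + P (l x - p) = l x" for x by (simp add: l_def idem)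
  have lp: "l p = p" by (simp add: l_def zero)
  define k where "k x = P (h (l x))" for x
  have dl: "(l has_derivative P) (at x within X)" for x X unfolding l_def
    by (auto intro!: derivative_eq_intros bounded_linear.has_derivative[OF bounded_linear])
  have cont: "continuous_on (ball p r0) k"
  proof -
    have "continuous_on (ball p r0) l" using dl by (rule has_derivative_continuous_on)
    moreover have "continuous_on S D1"
      using D2 has_derivative_continuous by (metis continuous_on_eq_continuous_within)
    ultimately have "continuous_on (ball p r0) (\<lambda>x. D1 (l x))"
      using lS by (intro continuous_on_compose2[of S D1 _ l]) auto
    then have "continuous_on (ball p r0) (\<lambda>x. h (l x))" unfolding h_def by (intro continuous_intros)
    then show ?thesis unfolding k_def by (intro bounded_linear.continuous_on[OF bounded_linear])
  qed
  have "\<exists>D. (k has_derivative D) (at p)"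
  proof -
    have pS: "p \<in> S" using r0 V by (simp add: S_def subspace_0)
    have "(D1 has_derivative D2 p) (at (l p) within l ` ball p r0)"
      using D2[OF pS] lS by (auto simp: lp intro: has_derivative_subset)
    then have "((\<lambda>x. D1 (l x)) has_derivative (\<lambda>v. D2 p (P v))) (at p within ball p r0)"
      by (rule has_derivative_in_compose[OF dl])
    then have "((\<lambda>x. D1 (l x) b) has_derivative (\<lambda>v. D2 p (P v) b)) (at p within ball p r0)" for b
      by (rule bounded_linear.has_derivative[OF blinfun.bounded_linear_left])
    then have "((\<lambda>x. h (l x)) has_derivative (\<lambda>v. \<Sum>b\<in>Basis. D2 p (P v) b *\<^sub>R b)) (at p within ball p r0)"
      unfolding h_def by (intro has_derivative_sum has_derivative_scaleR_left)
    then have "(k has_derivative (\<lambda>v. P (\<Sum>b\<in>Basis. D2 p (P v) b *\<^sub>R b))) (at p within ball p r0)"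
      unfolding k_def by (rule bounded_linear.has_derivative[OF bounded_linear])
    then show ?thesis using r0(1) by (subst (asm) at_within_open) auto
  qed
  then obtain D where D: "(k has_derivative D) (at p)" by blast
  let ?S = "subdifferential g p"
  have v0S: "v0 \<in> ?S" using v0 rel_interior_subset by blast
  obtain e where e: "e > 0" "ball v0 e \<inter> affine hull ?S \<subseteq> ?S"
    using v0 by (auto simp: mem_rel_interior_ball)
  \<comment> \<open>Half of \<open>e\<close>, so that the closed normal ball \<open>K\<close> below
    fits into the open ball granted by the relative interior.\<close>
  define \<epsilon> where "\<epsilon> = e / 2"
  have \<epsilon>: "\<epsilon> > 0" "\<epsilon> < e" using e by (auto simp: \<epsilon>_def)
  define K where "K = (+) v0 ` (V\<^sup>\<bottom> \<inter> cball 0 \<epsilon>)"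
  have compK: "compact K" unfolding K_def
    by (intro compact_translation closed_Int_compact closed_subspace subspace_orthogonal_comp compact_cball)
  have KS: "K \<subseteq> ?S"
  proof
    fix y assume "y \<in> K"
    then obtain n where n: "y = v0 + n" "n \<in> V\<^sup>\<bottom>" "norm n \<le> \<epsilon>" by (auto simp: K_def)
    obtain a0 where a0: "V\<^sup>\<bottom> = (+) a0 ` (affine hull ?S)"
      using ps by (auto simp: partly_smooth_def affine_parallel_def)
    have "a0 + v0 \<in> V\<^sup>\<bottom>" using a0 v0S hull_inc by fast
    then have "a0 + v0 + n \<in> V\<^sup>\<bottom>" using n(2) subspace_orthogonal_comp by (rule subspace_add[rotated])
    then have "y \<in> affine hull ?S" unfolding a0 n(1) by (auto simp: add.assoc)
    moreover have "y \<in> ball v0 e" using n \<epsilon> by (simp add: dist_norm)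
    ultimately show "y \<in> ?S" using e(2) by blast
  qed
  \<comment> \<open>A finite net makes the pointwise inner semicontinuity of the subdifferential
    uniform over \<open>K\<close>.\<close>
  obtain N where N: "finite N" "N \<subseteq> K" "K \<subseteq> (\<Union>c\<in>N. ball c (\<epsilon> / 4))"
    by (rule compact_imp_finite_net[OF compK, of "\<epsilon> / 4"]) (use \<epsilon> in auto)
  have "\<forall>\<^sub>F x in at p within M. \<forall>c\<in>N. \<exists>u\<in>subdifferential g x. dist u c < \<epsilon> / 4"
  proof (intro eventually_ball_finite[OF N(1)] ballI)
    fix c assume "c \<in> N"
    then have "c \<in> ?S" using N(2) KS by blast
    moreover have "\<epsilon> / 4 > 0" using \<epsilon> by simp
    ultimately show "\<forall>\<^sub>F x in at p within M. \<exists>u\<in>subdifferential g x. dist u c < \<epsilon> / 4"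
      using ps unfolding partly_smooth_def set_valued_continuous_within_def by (elim conjE) (drule (1) bspec, blast)
  qed
  then obtain \<eta> where \<eta>: "\<eta> > 0" "\<And>x c. \<lbrakk>x \<in> M; x \<noteq> p; dist x p < \<eta>; c \<in> N\<rbrakk>
      \<Longrightarrow> \<exists>u\<in>subdifferential g x. dist u c < \<epsilon> / 4"
    unfolding eventually_at by blast
  \<comment> \<open>The filter \<open>at p within M\<close> leaves out \<open>p\<close> itself,
    where the net already consists of subgradients.\<close>
  have near: "\<exists>u\<in>subdifferential g x. dist u c < \<epsilon> / 4" if "x \<in> M" "dist x p < \<eta>" "c \<in> N" for x c
  proof (cases "x = p")
    case True
    have "c \<in> ?S" using that N(2) KS by blast
    then show ?thesis using True \<epsilon> by (intro bexI[of _ c]) auto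
  qed (use \<eta>(2) that in blast)
  \<comment> \<open>The share \<open>\<epsilon> / 4\<close> for \<open>v\<close> and the error
    \<open>\<epsilon> / 2\<close> from the net add up to less than \<open>\<epsilon>\<close>, which
    gives the contradiction below.\<close>
  define r where "r = min r0 (min \<eta> (\<epsilon> / 4))"
  show ?thesis
  proof (rule prox_differentiable_if_tangential_subgradients[OF g \<gamma> orthogonal_projection_axioms _ _ D _ _ _ w])
    show "r > 0" using r0 \<eta> \<epsilon> by (simp add: r_def)
    show "continuous_on (ball p r) k" by (rule continuous_on_subset[OF cont]) (auto simp: r_def)
    show "k x = k (p + P (x - p))" for x by (simp add: k_def flip: l_def) (simp add: l_def idem)
    show "k x \<in> V" for x by (simp add: k_def mem)
    have "p \<in> S" using r0 V by (simp add: S_def subspace_0)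
    then show "P v0 = k p" using tangential v0S by (simp add: k_def lp)
  next
    fix x v assume x: "x \<in> ball p r" "x - p \<in> V" and v: "dist v v0 < r" "P v = k x"
    have xS: "x \<in> S" using x by (simp add: S_def r_def)
    then have xM: "x \<in> M" "\<bar>g x\<bar> \<noteq> \<infinity>" using subsetD[OF SM xS] U2(3)[OF subsetD[OF SM xS]] by (blast, simp)
    have xp: "dist x p < \<eta>" using x by (simp add: r_def dist_commute)
    have "l x = x" using fixed[OF x(2)] by (simp add: l_def)
    then have Pv: "P v = P u" if "u \<in> subdifferential g x" for u
      using tangential[OF xS that] v by (simp add: k_def)
    show "v \<in> subdifferential g x"
    proof (rule ccontr)
      assume "v \<notin> subdifferential g x"
      then obtain a b where ab: "a \<bullet> v < b" "\<And>u. u \<in> subdifferential g x \<Longrightarrow> b < a \<bullet> u"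
        using separating_hyperplane_closed_point subdifferential_closed_convex[of g x] xM(2) by meson
      \<comment> \<open>The normal part of \<open>a\<close> still separates, because
        \<open>v\<close> and all subgradients at \<open>x\<close> have the same tangential
        part.\<close>
      define a' where "a' = a - P a"
      have less: "a' \<bullet> v < a' \<bullet> u" if u: "u \<in> subdifferential g x" for u
      proof -
        have "P (v - u) = 0" using Pv[OF u] by (simp add: diff)
        then have "(v - u) \<bullet> P a = 0" using mem by (rule zero_inner)
        moreover have "a \<bullet> v < a \<bullet> u" using ab u by fastforce
        ultimately show ?thesis by (simp add: a'_def inner_diff_left inner_diff_right inner_commute)
      qed
      have "v0 \<in> K" using subspace_0[OF subspace_orthogonal_comp] \<epsilon> by (force simp: K_def)
      then obtain c0 where "c0 \<in> N" using N(3) by auto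
      then obtain u0 where u0: "u0 \<in> subdifferential g x" using near[OF xM(1) xp] by blast
      have a'0: "norm a' > 0" using less[OF u0] by auto
      \<comment> \<open>Moving from \<open>v0\<close> by \<open>\<epsilon>\<close> against
        \<open>a'\<close> stays in \<open>K\<close>; a subgradient at \<open>x\<close> close to this
        point lies on the wrong side.\<close>
      define n where "n = (- \<epsilon> / norm a') *\<^sub>R a'"
      have "n \<in> V\<^sup>\<bottom>" unfolding n_def a'_def by (intro subspace_scale subspace_orthogonal_comp compl_mem)
      moreover have "norm n = \<epsilon>" using a'0 \<epsilon> by (simp add: n_def)
      ultimately have "v0 + n \<in> K" by (auto simp: K_def)
      then obtain c where c: "c \<in> N" "dist c (v0 + n) < \<epsilon> / 4" using N(3) by auto
      then obtain u where u: "u \<in> subdifferential g x" "dist u c < \<epsilon> / 4" using near[OF xM(1) xp] by blast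
      have "dist u (v0 + n) < \<epsilon> / 2" using u(2) c(2) dist_triangle[of u "v0 + n" c] by simp
      then have "norm (u - (v0 + n)) \<le> \<epsilon> / 2" by (simp add: dist_norm)
      then have "a' \<bullet> (u - (v0 + n)) \<le> norm a' * (\<epsilon> / 2)"
        using norm_cauchy_schwarz[of a' "u - (v0 + n)"] mult_left_mono[of _ _ "norm a'"] norm_ge_zero
        by (meson order_trans)
      moreover have "a' \<bullet> n = - (norm a' * \<epsilon>)"
        using a'0 by (simp add: n_def power2_norm_eq_inner[symmetric] power2_eq_square)
      moreover have "norm (v0 - v) \<le> \<epsilon> / 4" using v(1) by (simp add: r_def dist_norm norm_minus_commute)
      then have "a' \<bullet> (v0 - v) \<le> norm a' * (\<epsilon> / 4)"
        using norm_cauchy_schwarz[of a' "v0 - v"] mult_left_mono[of _ _ "norm a'"] norm_ge_zero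
        by (meson order_trans)
      moreover have "norm a' * \<epsilon> > 0" using a'0 \<epsilon> by simp
      ultimately show False using less[OF u(1)] by (simp add: inner_diff_right inner_add_right mult.commute[of \<epsilon>])
    qed
  qed
qed

section \<open>Sums of norms of linear images\<close>

text \<open>Each \<open>q i\<close> is a dual certificate for its norm: Cauchy--Schwarz bounds the
  pairing with \<open>A i y\<close>, with equality at \<open>x\<close>. Sum over the blocks.\<close>

lemma sum_norm_subgradient:
  fixes A :: "'i \<Rightarrow> 'a::euclidean_space \<Rightarrow> 'b::euclidean_space"
  assumes lin: "\<And>i. i \<in> I \<Longrightarrow> linear (A i)" and lam: "lam \<ge> 0"
    and q: "\<And>i. i \<in> I \<Longrightarrow> norm (q i) \<le> 1" "\<And>i. i \<in> I \<Longrightarrow> q i \<bullet> A i x = norm (A i x)"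
  shows "lam *\<^sub>R (\<Sum>i\<in>I. adjoint (A i) (q i)) \<in> subdifferential (\<lambda>x. ereal (lam * (\<Sum>i\<in>I. norm (A i x)))) x"
proof -
  have "lam * (\<Sum>i\<in>I. norm (A i x)) + (lam *\<^sub>R (\<Sum>i\<in>I. adjoint (A i) (q i))) \<bullet> (y - x)
      \<le> lam * (\<Sum>i\<in>I. norm (A i y))" for y
  proof -
    have "norm (A i x) + adjoint (A i) (q i) \<bullet> (y - x) \<le> norm (A i y)" if "i \<in> I" for i
    proof -
      have "adjoint (A i) (q i) \<bullet> (y - x) = q i \<bullet> A i y - q i \<bullet> A i x"
        using lin[OF that] by (simp add: adjoint_works linear_diff inner_diff_right inner_commute)
      moreover have "q i \<bullet> A i y \<le> norm (q i) * norm (A i y)" by (rule norm_cauchy_schwarz)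
      moreover have "norm (q i) * norm (A i y) \<le> 1 * norm (A i y)"
        using q(1)[OF that] by (intro mult_right_mono) auto
      ultimately show ?thesis using q(2)[OF that] by simp
    qed
    then have "(\<Sum>i\<in>I. norm (A i x) + adjoint (A i) (q i) \<bullet> (y - x)) \<le> (\<Sum>i\<in>I. norm (A i y))"
      by (rule sum_mono)
    then have "lam * ((\<Sum>i\<in>I. norm (A i x)) + (\<Sum>i\<in>I. adjoint (A i) (q i)) \<bullet> (y - x))
        \<le> lam * (\<Sum>i\<in>I. norm (A i y))"
      using lam by (intro mult_left_mono) (simp_all add: sum.distrib inner_sum_left)
    then show ?thesis by (simp add: distrib_left)
  qed
  then show ?thesis by (simp add: subdifferential_def)
qed

text \<open>Vectors normal to the common kernel have preimages under the sum of the adjoints that depend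
  linearly on them: with \<open>N = \<Sum> A\<^sub>i\<^sup>* A\<^sub>i\<close>, the map \<open>N + P\<close> is invertible.\<close>

lemma common_kernel_normal_preimage:
  fixes A :: "'i \<Rightarrow> 'a::euclidean_space \<Rightarrow> 'b::euclidean_space"
  assumes J: "finite J" and lin: "\<And>i. i \<in> J \<Longrightarrow> linear (A i)"
    and P: "orthogonal_projection {x. \<forall>i\<in>J. A i x = 0} P"
  obtains B where "linear B" "\<And>m. P m = 0 \<Longrightarrow> m = (\<Sum>i\<in>J. adjoint (A i) (A i (B m)))"
proof -
  let ?V = "{x. \<forall>i\<in>J. A i x = 0}"
  interpret orthogonal_projection ?V P by (rule P)
  define N where "N y = (\<Sum>i\<in>J. adjoint (A i) (A i y))" for y
  have "linear (\<lambda>y. adjoint (A i) (A i y))" if "i \<in> J" for i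
    using linear_compose[OF lin[OF that] adjoint_linear[OF lin[OF that]]] by (simp add: o_def)
  then have linN: "linear N" unfolding N_def by (intro linear_compose_sum) blast
  have N: "N y \<bullet> x = (\<Sum>i\<in>J. A i y \<bullet> A i x)" for x y
    unfolding N_def inner_sum_left by (intro sum.cong refl) (simp add: lin adjoint_works inner_commute)
  have PN: "P (N y) = 0" for y
  proof -
    have "P (N y) = P 0" by (rule eqI) (simp add: N)
    then show ?thesis by (simp add: zero)
  qed
  let ?E = "\<lambda>y. N y + P y"
  have linE: "linear ?E" using linN linear by (rule linear_compose_add)
  \<comment> \<open>Applying \<open>P\<close> removes the \<open>N\<close> part, so
    \<open>P y = 0\<close>. Then \<open>N y \<bullet> y\<close>, a sum of squares, vanishes, which
    puts \<open>y\<close> into the common kernel, where \<open>P\<close> is the identity.\<close>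
  have "y = 0" if E: "?E y = 0" for y
  proof -
    have "P (?E y) = P y" by (simp add: add PN idem)
    then have Py: "P y = 0" using E zero by simp
    then have "N y \<bullet> y = 0" using E by simp
    then have "\<forall>i\<in>J. A i y \<bullet> A i y = 0" unfolding N by (subst (asm) sum_nonneg_eq_0_iff[OF J]) auto
    then have "y \<in> ?V" by simp
    from fixed[OF this] Py show ?thesis by simp
  qed
  then have inj: "inj ?E" unfolding linear_injective_0[OF linE] by blast
  have surj: "surj ?E" using linear_injective_imp_surjective[OF linE inj] by simp
  show thesis
  proof (rule that)
    show "linear (inv ?E)" by (rule inj_linear_imp_inv_linear[OF linE inj])
    fix m assume m: "P m = 0"
    have E: "N (inv ?E m) + P (inv ?E m) = m" using surj_f_inv_f[OF surj, of m] by simp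
    then have "P (N (inv ?E m) + P (inv ?E m)) = 0" using m by simp
    then have "P (inv ?E m) = 0" by (simp add: add PN idem)
    then show "m = (\<Sum>i\<in>J. adjoint (A i) (A i (inv ?E m)))" using E by (simp add: N_def)
  qed
qed

text \<open>The blocks vanishing at \<open>p\<close> define \<open>V\<close>; the other norms are
  smooth near \<open>p\<close>. Strictness in \<open>q2\<close> leaves room to absorb small normal
  changes of the subgradient.\<close>

lemma prox_differentiable_sum_norm:
  fixes A :: "'i \<Rightarrow> 'a::euclidean_space \<Rightarrow> 'b::euclidean_space"
  assumes I: "finite I" and lin: "\<And>i. i \<in> I \<Longrightarrow> linear (A i)" and lam: "lam > 0"
    and g: "proper_closed_convex g" and \<gamma>: "\<gamma> > 0"
    and geq: "g = (\<lambda>x. ereal (lam * (\<Sum>i\<in>I. norm (A i x))))"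
    and v0: "v0 = lam *\<^sub>R (\<Sum>i\<in>I. adjoint (A i) (q i))" and w: "w = p + \<gamma> *\<^sub>R v0"
    and q1: "\<And>i. i \<in> I \<Longrightarrow> A i p \<noteq> 0 \<Longrightarrow> q i = A i p /\<^sub>R norm (A i p)"
    and q2: "\<And>i. i \<in> I \<Longrightarrow> A i p = 0 \<Longrightarrow> norm (q i) < 1"
  shows "prox \<gamma> g differentiable (at w)"
proof -
  define J K where "J = {i\<in>I. A i p = 0}" and "K = {i\<in>I. A i p \<noteq> 0}"
  have JK: "finite J" "finite K" "I = J \<union> K" "J \<inter> K = {}" using I by (auto simp: J_def K_def)
  have linJ: "linear (A i)" if "i \<in> J" for i using that lin by (simp add: J_def)
  have linK: "linear (A i)" if "i \<in> K" for i using that lin by (simp add: K_def)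
  have linad: "linear (adjoint (A i))" if "i \<in> I" for i using that lin adjoint_linear by blast
  define V where "V = {x. \<forall>i\<in>J. A i x = 0}"
  have V: "subspace V" unfolding V_def
    by (rule subspaceI) (use linJ in \<open>auto simp: linear_0 linear_add linear_scale\<close>)
  obtain P where P: "orthogonal_projection V P" using orthogonal_projection_exists[OF V] .
  then interpret orthogonal_projection V P .
  obtain B where B: "linear B" "\<And>m. P m = 0 \<Longrightarrow> m = (\<Sum>i\<in>J. adjoint (A i) (A i (B m)))"
    using common_kernel_normal_preimage[of J A P] JK linJ P unfolding V_def by blast
  \<comment> \<open>Gradient of the norm at \<open>A i x\<close>. Below, \<open>u\<close> collects
    the smooth blocks and \<open>c\<close> the vanishing ones, whose contribution is normal to
    \<open>V\<close>.\<close>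
  define s where "s i x = A i x /\<^sub>R norm (A i x)" for i x
  define u where "u x = lam *\<^sub>R (\<Sum>i\<in>K. adjoint (A i) (s i x))" for x
  define c where "c = lam *\<^sub>R (\<Sum>i\<in>J. adjoint (A i) (q i))"
  have v0': "v0 = u p + c"
    unfolding v0 u_def c_def JK(3) sum.union_disjoint[OF JK(1,2,4)]
    by (simp add: s_def q1 K_def scaleR_add_right)
  have Pc: "P c = 0"
  proof -
    have "P c = P 0"
    proof (rule eqI)
      fix d assume "d \<in> V"
      then have "adjoint (A i) (q i) \<bullet> d = 0" if "i \<in> J" for i
        using linJ[OF that] that by (simp add: V_def adjoint_works inner_commute)
      then show "c \<bullet> d = 0 \<bullet> d" by (simp add: c_def inner_sum_left)
    qed
    then show ?thesis by (simp add: zero)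
  qed
  define l where "l x = p + P (x - p)" for x
  have dl: "(l has_derivative P) (at x within X)" for x X unfolding l_def
    by (auto intro!: derivative_eq_intros bounded_linear.has_derivative[OF bounded_linear])
  define k where "k x = P (u (l x))" for x
  have du: "u differentiable (at x)" if nz: "\<And>i. i \<in> K \<Longrightarrow> A i x \<noteq> 0" for x
  proof -
    have "s i differentiable (at x)" if "i \<in> K" for i
    proof -
      have "bounded_linear (A i)" using linK[OF that] by (simp add: linear_conv_bounded_linear)
      then have dA: "A i differentiable (at x)" by (rule bounded_linear_imp_differentiable)
      have "(\<lambda>x. norm (A i x)) differentiable (at x)"
        by (rule differentiable_compose[OF _ dA]) (rule differentiable_norm_at[OF nz[OF that]])
      then have "(\<lambda>x. inverse (norm (A i x))) differentiable (at x)"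
        by (rule differentiable_inverse) (use nz[OF that] in simp)
      then show ?thesis unfolding s_def using dA by (rule differentiable_scaleR)
    qed
    then have "(\<lambda>x. adjoint (A i) (s i x)) differentiable (at x)" if i: "i \<in> K" for i
    proof -
      obtain D where "(s i has_derivative D) (at x)"
        using \<open>\<And>i. i \<in> K \<Longrightarrow> s i differentiable (at x)\<close>[OF i] by (auto simp: differentiable_def)
      moreover have "bounded_linear (adjoint (A i))"
        using linad[of i] i JK(3) by (simp add: linear_conv_bounded_linear)
      ultimately show ?thesis using bounded_linear.has_derivative differentiableI by metis
    qed
    then show ?thesis unfolding u_def
      by (intro differentiable_scaleR differentiable_const differentiable_sum JK(2) ballI)
  qed
  have "\<forall>\<^sub>F x in nhds p. \<forall>i\<in>K. A i x \<noteq> 0"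
  proof (intro eventually_ball_finite[OF JK(2)] ballI)
    fix i assume i: "i \<in> K"
    have "open {x. A i x \<noteq> 0}"
      using linK[OF i] by (intro open_Collect_neq continuous_on_const linear_continuous_on)
        (simp add: linear_conv_bounded_linear)
    then show "\<forall>\<^sub>F x in nhds p. A i x \<noteq> 0" using i eventually_nhds_in_open[of _ p] by (fastforce simp: K_def)
  qed
  then obtain r1 where r1: "r1 > 0" "\<And>x i. dist x p < r1 \<Longrightarrow> i \<in> K \<Longrightarrow> A i x \<noteq> 0"
    unfolding eventually_nhds_metric by blast
  \<comment> \<open>Linearity of \<open>B\<close> makes the correction continuous and zero at
    \<open>m = 0\<close>, so the strict bounds survive for small \<open>m\<close>.\<close>
  have "\<forall>\<^sub>F m in nhds 0. \<forall>i\<in>J. norm (q i + (1 / lam) *\<^sub>R A i (B m)) < 1"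
  proof (intro eventually_ball_finite[OF JK(1)] ballI)
    fix i assume i: "i \<in> J"
    let ?f = "\<lambda>m. norm (q i + (1 / lam) *\<^sub>R A i (B m))"
    have lAB: "linear (\<lambda>m. A i (B m))" using linear_compose[OF B(1) linJ[OF i]] by (simp add: o_def)
    then have "isCont (\<lambda>m. A i (B m)) 0" by (simp add: linear_continuous_at linear_conv_bounded_linear)
    then have "isCont ?f 0" by (intro continuous_intros)
    moreover have "?f 0 < 1" using i q2 linear_0[OF lAB] by (simp add: J_def)
    ultimately show "\<forall>\<^sub>F m in nhds 0. ?f m < 1"
      unfolding isCont_def tendsto_at_iff_tendsto_nhds[of ?f] by (rule order_tendstoD)
  qed
  then obtain e where e: "e > 0" "\<And>m i. norm m < e \<Longrightarrow> i \<in> J \<Longrightarrow> norm (q i + (1 / lam) *\<^sub>R A i (B m)) < 1"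
    unfolding eventually_nhds_metric dist_norm by auto
  have "u differentiable (at p)" by (rule du) (simp add: K_def)
  then obtain u' where u': "(u has_derivative u') (at p)" by (auto simp: differentiable_def)
  then have "isCont u p" using has_derivative_continuous by blast
  then have "\<forall>\<^sub>F x in nhds p. dist (u x) (u p) < e / 2"
    unfolding isCont_def tendsto_at_iff_tendsto_nhds by (rule tendstoD) (use e in simp)
  then obtain r2 where r2: "r2 > 0" "\<And>x. dist x p < r2 \<Longrightarrow> dist (u x) (u p) < e / 2"
    unfolding eventually_nhds_metric by blast
  define r where "r = min r1 (min r2 (e / 2))"
  have r: "r > 0" using r1 r2 e by (simp add: r_def)
  have lp: "l p = p" by (simp add: l_def zero)
  show ?thesis
  proof (rule prox_differentiable_if_tangential_subgradients[OF g \<gamma> P r _ _ _ _ _ w])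
    have "(u has_derivative u') (at (l p))" using u' by (simp add: lp)
    then have "((\<lambda>x. u (l x)) has_derivative (\<lambda>v. u' (P v))) (at p)"
      by (rule has_derivative_compose[OF dl])
    then show "(k has_derivative (\<lambda>v. P (u' (P v)))) (at p)"
      unfolding k_def by (rule bounded_linear.has_derivative[OF bounded_linear])
    show "continuous_on (ball p r) k"
    proof (rule continuous_at_imp_continuous_on, rule ballI)
      fix x assume "x \<in> ball p r"
      then have "dist (l x) p < r1"
        using norm_le[of "x - p"] by (simp add: l_def dist_norm r_def norm_minus_commute)
      then have "u differentiable (at (l x))" using r1 by (intro du) auto
      then obtain u'' where "(u has_derivative u'') (at (l x))" by (auto simp: differentiable_def)
      then have "((\<lambda>x. u (l x)) has_derivative (\<lambda>v. u'' (P v))) (at x)"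
        by (rule has_derivative_compose[OF dl])
      then have "(k has_derivative (\<lambda>v. P (u'' (P v)))) (at x)"
        unfolding k_def by (rule bounded_linear.has_derivative[OF bounded_linear])
      then show "isCont k x" using has_derivative_continuous by blast
    qed
    show "k x = k (p + P (x - p))" for x by (simp add: k_def l_def idem)
    show "k x \<in> V" for x by (simp add: k_def mem)
    show "P v0 = k p" by (simp add: v0' add Pc k_def lp)
  next
    fix x v assume x: "x \<in> ball p r" "x - p \<in> V" and v: "dist v v0 < r" "P v = k x"
    \<comment> \<open>The normal discrepancy: its tangential part vanishes because
      \<open>P v = k x\<close>, and \<open>B\<close> distributes it over the blocks in
      \<open>J\<close>.\<close>
    define m where "m = v - u x - c"
    have "l x = x" using fixed[OF x(2)] by (simp add: l_def)
    then have "P m = 0" using v by (simp add: m_def diff Pc k_def)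
    note Bm = B(2)[OF this]
    have "m = (v - v0) - (u x - u p)" by (simp add: m_def v0')
    then have "norm m \<le> norm (v - v0) + norm (u x - u p)" by (simp add: norm_triangle_ineq4)
    moreover have "norm (u x - u p) < e / 2" using r2(2)[of x] x by (simp add: dist_norm r_def norm_minus_commute)
    ultimately have m: "norm m < e" using v by (simp add: dist_norm r_def)
    define q' where "q' i = (if i \<in> J then q i + (1 / lam) *\<^sub>R A i (B m) else s i x)" for i
    have "lam *\<^sub>R (\<Sum>i\<in>I. adjoint (A i) (q' i))
      = lam *\<^sub>R (\<Sum>i\<in>J. adjoint (A i) (q' i)) + lam *\<^sub>R (\<Sum>i\<in>K. adjoint (A i) (q' i))"
      unfolding JK(3) sum.union_disjoint[OF JK(1,2,4)] by (rule scaleR_add_right)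
    also have "(\<Sum>i\<in>K. adjoint (A i) (q' i)) = (\<Sum>i\<in>K. adjoint (A i) (s i x))"
      using JK(4) by (intro sum.cong) (auto simp: q'_def)
    also have "(\<Sum>i\<in>J. adjoint (A i) (q' i)) = (\<Sum>i\<in>J. adjoint (A i) (q i) + (1 / lam) *\<^sub>R adjoint (A i) (A i (B m)))"
      using linad JK(3) by (intro sum.cong refl) (simp add: q'_def linear_add linear_scale)
    also have "\<dots> = (\<Sum>i\<in>J. adjoint (A i) (q i)) + (1 / lam) *\<^sub>R m"
      unfolding sum.distrib scaleR_sum_right[symmetric] Bm[symmetric] ..
    finally have "lam *\<^sub>R (\<Sum>i\<in>I. adjoint (A i) (q' i)) = v"
      using lam by (simp add: scaleR_add_right m_def c_def u_def)
    moreover have "lam *\<^sub>R (\<Sum>i\<in>I. adjoint (A i) (q' i)) \<in> subdifferential g x" unfolding geq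
    proof (rule sum_norm_subgradient[OF lin])
      fix i assume i: "i \<in> I"
      \<comment> \<open>If \<open>A i x\<close> vanishes for some \<open>i\<close> outside
        \<open>J\<close>, inversion at 0 gives \<open>s i x = 0\<close>, which also meets both
        conditions.\<close>
      show "norm (q' i) \<le> 1"
        using e(2)[OF m, of i] by (cases "A i x = 0") (auto simp: q'_def s_def)
      show "q' i \<bullet> A i x = norm (A i x)"
      proof (cases "i \<in> J")
        case True
        then have "A i (x - p) = 0" "A i p = 0" using x by (auto simp: V_def J_def)
        then have "A i x = 0" using linear_diff[OF linJ[OF True], of x p] by simp
        then show ?thesis by simp
      next
        case False
        then show ?thesis
          by (cases "A i x = 0") (simp_all add: q'_def s_def power2_norm_eq_inner[symmetric] power2_eq_square)
      qed
    qed (use lam in auto)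
    ultimately show "v \<in> subdifferential g x" by simp
  qed
qed

section \<open>The Douglas--Rachford map\<close>

lemma proper_closed_convex_real:
  fixes f :: "'a::euclidean_space \<Rightarrow> real"
  assumes "convex_on UNIV f"
  shows "proper_closed_convex (\<lambda>x. ereal (f x))"
proof -
  have E: "ereal_epigraph (\<lambda>x. ereal (f x)) = epigraph UNIV f"
    by (auto simp: ereal_epigraph_def epigraph_def)
  have "continuous_on UNIV f" by (rule convex_on_continuous[OF open_UNIV assms])
  then have "continuous_on UNIV (\<lambda>z::'a \<times> real. f (fst z))"
    by (rule continuous_on_compose2) (auto intro: continuous_intros)
  then have "closed {z::'a \<times> real. f (fst z) \<le> snd z}"
    by (rule closed_Collect_le) (intro continuous_intros)
  then have "closed (epigraph UNIV f)" by (simp add: epigraph_def)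
  with assms show ?thesis unfolding proper_closed_convex_def E convex_epigraph by simp
qed

text \<open>The subgradient supplied by the prox must be the gradient, so the prox inverts the
  forward map \<open>\<lambda>x. x + \<gamma> *\<^sub>R f' x\<close>.\<close>

lemma smooth_prox_eq:
  fixes f :: "'a::euclidean_space \<Rightarrow> real"
  assumes f: "convex_on UNIV f" and f': "\<And>x. GDERIV f x :> f' x" and \<gamma>: "\<gamma> > 0"
    and p: "p = prox \<gamma> (\<lambda>x. ereal (f x)) z"
  shows "z = p + \<gamma> *\<^sub>R f' p"
proof -
  let ?v = "(1 / \<gamma>) *\<^sub>R (z - p)"
  have v: "?v \<in> subdifferential (\<lambda>x. ereal (f x)) p"
    unfolding p by (rule prox_subdifferential[OF proper_closed_convex_real[OF f] \<gamma>])
  have "d \<bullet> f' p = ?v \<bullet> d" for d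
    by (rule subgradient_eq_derivative[OF v, where S = UNIV and e = 1])
      (use f'[of p] in \<open>simp_all add: gderiv_def\<close>)
  then have "f' p = ?v" by (metis inner_commute vector_eq_ldot)
  then show ?thesis using \<gamma> by simp
qed

lemma reflected_prox_contraction:
  fixes f :: "'a::euclidean_space \<Rightarrow> real"
  assumes f: "convex_on UNIV f" and f': "\<And>x. GDERIV f x :> f' x" and \<gamma>: "\<gamma> > 0"
    and \<sigma>: "0 < \<sigma>" "\<sigma> \<le> \<beta>" and sc: "strongly_convex \<sigma> f" and lip: "\<beta>-lipschitz_on UNIV f'"
  shows "norm (reflected_prox \<gamma> (\<lambda>x. ereal (f x)) x - reflected_prox \<gamma> (\<lambda>x. ereal (f x)) y)
    \<le> max ((\<gamma> * \<beta> - 1) / (\<gamma> * \<beta> + 1)) ((1 - \<gamma> * \<sigma>) / (1 + \<gamma> * \<sigma>)) * norm (x - y)"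
proof -
  let ?P = "prox \<gamma> (\<lambda>x. ereal (f x))"
  define a b where "a = ?P x - ?P y" and "b = f' (?P x) - f' (?P y)"
  have z: "z = ?P z + \<gamma> *\<^sub>R f' (?P z)" for z by (rule smooth_prox_eq[OF f f' \<gamma> refl])
  have "x - y = (?P x + \<gamma> *\<^sub>R f' (?P x)) - (?P y + \<gamma> *\<^sub>R f' (?P y))"
    using z[of x] z[of y] by simp
  then have xy: "x - y = a + \<gamma> *\<^sub>R b" by (simp add: a_def b_def algebra_simps)
  have "reflected_prox \<gamma> (\<lambda>x. ereal (f x)) x - reflected_prox \<gamma> (\<lambda>x. ereal (f x)) y = 2 *\<^sub>R a - (x - y)"
    by (simp add: reflected_prox_def a_def algebra_simps)
  also have "\<dots> = a - \<gamma> *\<^sub>R b" unfolding xy by (simp add: algebra_simps scaleR_2)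
  finally have R: "reflected_prox \<gamma> (\<lambda>x. ereal (f x)) x - reflected_prox \<gamma> (\<lambda>x. ereal (f x)) y = a - \<gamma> *\<^sub>R b" .
  show ?thesis unfolding R unfolding xy
    by (rule reflected_resolvent_contraction[OF \<gamma> \<sigma>])
      (unfold a_def b_def, rule strongly_convex_lipschitz_gradient[OF sc f' lip \<sigma>(2)])
qed

text \<open>The outer reflection is nonexpansive and the inner one has constant
  \<open>\<delta>\<close>; the relaxation adds its own weight.\<close>

lemma drs_map_lipschitz:
  fixes g :: "'a::euclidean_space \<Rightarrow> ereal"
  assumes g: "proper_closed_convex g" and \<gamma>: "\<gamma> > 0" and \<alpha>: "\<alpha> \<ge> 0"
    and R: "\<And>x y. norm (reflected_prox \<gamma> f x - reflected_prox \<gamma> f y) \<le> \<delta> * norm (x - y)"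
  shows "norm (drs_map \<alpha> \<gamma> f g x - drs_map \<alpha> \<gamma> f g y) \<le> (\<bar>1 - \<alpha>\<bar> + \<alpha> * \<delta>) * norm (x - y)"
proof -
  let ?R = "\<lambda>z. reflected_prox \<gamma> g (reflected_prox \<gamma> f z)"
  have "norm (?R x - ?R y) \<le> norm (reflected_prox \<gamma> f x - reflected_prox \<gamma> f y)"
    by (rule reflected_prox_nonexpansive[OF g \<gamma>])
  also have "\<dots> \<le> \<delta> * norm (x - y)" by (rule R)
  finally have "\<alpha> * norm (?R x - ?R y) \<le> \<alpha> * (\<delta> * norm (x - y))" using \<alpha> by (rule mult_left_mono)
  moreover have "drs_map \<alpha> \<gamma> f g x - drs_map \<alpha> \<gamma> f g y = (1 - \<alpha>) *\<^sub>R (x - y) + \<alpha> *\<^sub>R (?R x - ?R y)"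
    by (simp add: drs_map_def algebra_simps)
  then have "norm (drs_map \<alpha> \<gamma> f g x - drs_map \<alpha> \<gamma> f g y) \<le> \<bar>1 - \<alpha>\<bar> * norm (x - y) + \<alpha> * norm (?R x - ?R y)"
    using norm_triangle_ineq[of "(1 - \<alpha>) *\<^sub>R (x - y)" "\<alpha> *\<^sub>R (?R x - ?R y)"] \<alpha> by simp
  ultimately show ?thesis by (simp add: distrib_right mult.assoc)
qed

lemma gradient_monotone:
  assumes "strongly_convex \<sigma> f" "\<sigma> \<ge> 0" and f': "\<And>x. GDERIV f x :> f' x"
  shows "0 \<le> (f' x - f' y) \<bullet> (x - y)"
proof -
  have "0 \<le> \<sigma> / 2 * (norm (y - x))\<^sup>2" "0 \<le> \<sigma> / 2 * (norm (x - y))\<^sup>2" using assms(2) by auto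
  then have "f x + f' x \<bullet> (y - x) \<le> f y" "f y + f' y \<bullet> (x - y) \<le> f x"
    using strongly_convex_lower_bound[OF assms(1) f', of x y]
      strongly_convex_lower_bound[OF assms(1) f', of y x] by linarith+
  then show ?thesis by (simp add: inner_diff_left inner_diff_right)
qed

text \<open>The prox is a nonexpansive inverse of the forward map \<open>F\<close>. Being
  continuous, it is differentiable at \<open>z\<close> once \<open>F\<close> has an invertible
  derivative at \<open>p\<close>, and monotonicity supplies the invertibility.\<close>

lemma smooth_prox_has_derivative:
  fixes f :: "'a::euclidean_space \<Rightarrow> real"
  assumes f: "convex_on UNIV f" and f': "\<And>x. GDERIV f x :> f' x" and \<gamma>: "\<gamma> > 0"
    and mono: "\<And>x y. 0 \<le> (f' x - f' y) \<bullet> (x - y)"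
    and p: "p = prox \<gamma> (\<lambda>x. ereal (f x)) z" and H: "(f' has_derivative H) (at p)"
  shows "bij (\<lambda>v. v + \<gamma> *\<^sub>R H v)"
    and "(prox \<gamma> (\<lambda>x. ereal (f x)) has_derivative inv (\<lambda>v. v + \<gamma> *\<^sub>R H v)) (at z)"
proof -
  let ?P = "prox \<gamma> (\<lambda>x. ereal (f x))" and ?G = "\<lambda>v. v + \<gamma> *\<^sub>R H v"
  define F where "F x = x + \<gamma> *\<^sub>R f' x" for x
  note fp = proper_closed_convex_real[OF f]
  have FP: "F (?P x) = x" for x unfolding F_def using smooth_prox_eq[OF f f' \<gamma> refl] by simp
  have "0 \<le> H v \<bullet> v" for v by (rule has_derivative_inner_nonneg[OF H open_UNIV]) (simp_all add: mono)
  note G = bij_id_plus_monotone[OF has_derivative_linear[OF H] this \<gamma>]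
  show "bij ?G" by (rule G)
  have "norm (?P x - ?P y) \<le> norm (x - y)" for x y
  proof -
    have "(norm (?P x - ?P y))\<^sup>2 \<le> norm (x - y) * norm (?P x - ?P y)"
      using prox_monotone[OF fp \<gamma>, of x y] norm_cauchy_schwarz order_trans by blast
    then show ?thesis by (cases "?P x = ?P y") (auto simp: power2_eq_square)
  qed
  then have "isCont ?P x" for x
    unfolding continuous_at_eps_delta dist_norm by (meson le_less_trans)
  then have cont: "isCont ?P (F p)" .
  have Fp: "F p = z" unfolding p by (rule FP)
  have "(?P has_derivative inv ?G) (at (F p))"
  proof (rule has_derivative_inverse_basic_x[where f = F and f' = ?G and T = UNIV])
    show "(F has_derivative ?G) (at p)" unfolding F_def by (intro derivative_intros H)
    show "bounded_linear (inv ?G)"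
      using G by (simp add: bij_is_inj inj_linear_imp_inv_linear linear_conv_bounded_linear[symmetric])
    show "inv ?G \<circ> ?G = id" using G by (simp add: bij_is_inj)
    show "?P (F p) = p" by (subst Fp) (rule p[symmetric])
  qed (simp_all add: cont FP)
  then show "(?P has_derivative inv ?G) (at z)" unfolding Fp .
qed

text \<open>Chain rule through the two reflections; the \<open>let\<close> spells out the
  composition of \<open>2Q - I\<close> with \<open>2F - I\<close>.\<close>

lemma drs_map_has_derivative:
  fixes f g :: "'a::real_normed_vector \<Rightarrow> ereal"
  assumes f: "(prox \<gamma> f has_derivative F) (at z)"
    and g: "(prox \<gamma> g has_derivative Q) (at (reflected_prox \<gamma> f z))"
  shows "(drs_map \<alpha> \<gamma> f g has_derivative
    (\<lambda>v. (1 - \<alpha>) *\<^sub>R v + \<alpha> *\<^sub>R (let u = 2 *\<^sub>R F v - v in 2 *\<^sub>R Q u - u))) (at z)"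
proof -
  have 1: "(reflected_prox \<gamma> f has_derivative (\<lambda>v. 2 *\<^sub>R F v - v)) (at z)"
    unfolding reflected_prox_def[abs_def] by (intro derivative_intros f)
  have "(reflected_prox \<gamma> g has_derivative (\<lambda>v. 2 *\<^sub>R Q v - v)) (at (reflected_prox \<gamma> f z))"
    unfolding reflected_prox_def[of \<gamma> g, abs_def] by (intro derivative_intros g)
  from has_derivative_compose[OF 1 this] show ?thesis
    unfolding drs_map_def[abs_def] Let_def by (intro derivative_intros)
qed

section \<open>Perturbed iterations of a contraction\<close>

lemma geometric_decay_tendsto_0:
  fixes e :: "nat \<Rightarrow> real"
  assumes "\<And>k. 0 \<le> e k" and c: "0 \<le> c" "c < 1" and "\<forall>\<^sub>F k in sequentially. e (Suc k) \<le> c * e k"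
  shows "e \<longlonglongrightarrow> 0"
proof -
  obtain K where K: "\<And>k. k \<ge> K \<Longrightarrow> e (Suc k) \<le> c * e k"
    using assms(4) by (auto simp: eventually_sequentially)
  have "e (n + K) \<le> c ^ n * e K" for n
  proof (induction n)
    case (Suc n)
    have "e (Suc n + K) \<le> c * e (n + K)" using K[of "n + K"] by simp
    also have "\<dots> \<le> c * (c ^ n * e K)" using Suc c by (intro mult_left_mono) auto
    finally show ?case by (simp add: mult.assoc)
  qed simp
  moreover have "(\<lambda>n. c ^ n * e K) \<longlonglongrightarrow> 0 * e K" using c by (intro tendsto_intros LIMSEQ_realpow_zero)
  ultimately have "(\<lambda>n. e (n + K)) \<longlonglongrightarrow> 0"
    using assms(1) by (intro tendsto_sandwich[OF _ _ tendsto_const, of 0 "\<lambda>n. e (n + K)" _ "\<lambda>n. c ^ n * e K"]) auto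
  then show ?thesis by (rule LIMSEQ_offset)
qed

text \<open>The perturbation is small only relative to the current error, so convergence must be
  derived: eventually it uses up at most half of the contraction gap.\<close>

lemma perturbed_contraction_tendsto:
  fixes T :: "'a::real_normed_vector \<Rightarrow> 'a"
  assumes T: "\<And>x y. norm (T x - T y) \<le> q * norm (x - y)" "q < 1" and fp: "T z0 = z0"
    and z: "\<And>k. z (Suc k) = T (z k) + \<epsilon> (Suc k)"
    and \<epsilon>: "(\<lambda>k. norm (\<epsilon> (Suc k))) \<in> o(\<lambda>k. norm (z k - z0))"
  shows "z \<longlonglongrightarrow> z0"
proof -
  \<comment> \<open>Clipped at 0, since the geometric rate must be nonnegative.\<close>
  define c where "c = max 0 q"
  have c: "0 \<le> c" "c < 1" "q \<le> c" using T(2) by (auto simp: c_def)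
  have "\<forall>\<^sub>F k in sequentially. norm (norm (\<epsilon> (Suc k))) \<le> (1 - c) / 2 * norm (norm (z k - z0))"
    by (rule landau_o.smallD[OF \<epsilon>]) (use c in simp)
  then have "\<forall>\<^sub>F k in sequentially. norm (z (Suc k) - z0) \<le> ((1 + c) / 2) * norm (z k - z0)"
  proof eventually_elim
    case (elim k)
    have "z (Suc k) - z0 = (T (z k) - T z0) + \<epsilon> (Suc k)" by (simp add: z fp)
    then have "norm (z (Suc k) - z0) \<le> norm (T (z k) - T z0) + norm (\<epsilon> (Suc k))"
      by (metis norm_triangle_ineq)
    also have "norm (T (z k) - T z0) \<le> q * norm (z k - z0)" by (rule T)
    also have "\<dots> \<le> c * norm (z k - z0)" using c by (intro mult_right_mono) auto
    finally have "norm (z (Suc k) - z0) \<le> c * norm (z k - z0) + (1 - c) / 2 * norm (z k - z0)"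
      using elim by simp
    also have "\<dots> = ((1 + c) / 2) * norm (z k - z0)" by (simp add: field_simps)
    finally show ?case .
  qed
  then have "(\<lambda>k. norm (z k - z0)) \<longlonglongrightarrow> 0"
    using c by (intro geometric_decay_tendsto_0[where c = "(1 + c) / 2"]) auto
  then show ?thesis by (simp add: tendsto_norm_zero_iff LIM_zero_iff)
qed

text \<open>The definition of the derivative at a fixed point. The general filter covers both a free
  variable tending to \<open>z0\<close> and the sequence of iterates.\<close>

lemma fixed_point_expansion:
  fixes T :: "'a::real_normed_vector \<Rightarrow> 'a"
  assumes L: "(T has_derivative L) (at z0)" and fp: "T z0 = z0" and lim: "(x \<longlongrightarrow> z0) F"
  shows "(\<lambda>k. norm ((T (x k) - x k) - (L (x k - z0) - (x k - z0)))) \<in> o[F](\<lambda>k. norm (x k - z0))"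
proof (rule landau_o.smallI)
  fix c :: real assume "c > 0"
  \<comment> \<open>This form of the derivative includes \<open>y = z0\<close>, so iterates that hit
    the fixed point are covered.\<close>
  then obtain d where d: "d > 0" "\<And>y. norm (y - z0) < d \<Longrightarrow> norm (T y - T z0 - L (y - z0)) \<le> c * norm (y - z0)"
    using L unfolding has_derivative_at_alt by blast
  have "\<forall>\<^sub>F k in F. dist (x k) z0 < d" using lim d(1) by (rule tendstoD)
  then show "\<forall>\<^sub>F k in F. norm (norm ((T (x k) - x k) - (L (x k - z0) - (x k - z0)))) \<le> c * norm (norm (x k - z0))"
  proof eventually_elim
    case (elim k)
    have "norm (T (x k) - T z0 - L (x k - z0)) \<le> c * norm (x k - z0)"
      using elim by (intro d) (simp add: dist_norm)
    moreover have "(T (x k) - x k) - (L (x k - z0) - (x k - z0)) = T (x k) - T z0 - L (x k - z0)"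
      unfolding fp by simp
    ultimately show ?case by (simp only: real_norm_def abs_norm_cancel)
  qed
qed

text \<open>Convergence lets the expansion of \<open>T\<close> be used along the iterates; the
  perturbation has lower order and joins the remainder.\<close>

lemma perturbed_iteration_expansion:
  fixes T :: "'a::real_normed_vector \<Rightarrow> 'a"
  assumes T: "\<And>x y. norm (T x - T y) \<le> q * norm (x - y)" "q < 1" and fp: "T z0 = z0"
    and L: "(T has_derivative L) (at z0)"
    and z: "\<And>k. z (Suc k) = T (z k) + \<epsilon> (Suc k)"
    and \<epsilon>: "(\<lambda>k. norm (\<epsilon> (Suc k))) \<in> o(\<lambda>k. norm (z k - z0))"
  shows "(\<lambda>k. norm ((z (Suc k) - z k) - (L (z k - z0) - (z k - z0)))) \<in> o(\<lambda>k. norm (z k - z0))"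
proof -
  let ?E = "\<lambda>k. (T (z k) - z k) - (L (z k - z0) - (z k - z0))"
  have "z \<longlonglongrightarrow> z0" by (rule perturbed_contraction_tendsto[OF T fp z \<epsilon>])
  from fixed_point_expansion[OF L fp this]
  have "(\<lambda>k. norm (?E k) + norm (\<epsilon> (Suc k))) \<in> o(\<lambda>k. norm (z k - z0))"
    using \<epsilon> by (rule sum_in_smallo)
  moreover have "(\<lambda>k. norm ((z (Suc k) - z k) - (L (z k - z0) - (z k - z0)))) \<in> O(\<lambda>k. norm (?E k) + norm (\<epsilon> (Suc k)))"
  proof (rule landau_o.big_mono, rule always_eventually, rule allI)
    fix k
    have eq: "(z (Suc k) - z k) - (L (z k - z0) - (z k - z0)) = ?E k + \<epsilon> (Suc k)" by (simp add: z)
    have "norm (?E k + \<epsilon> (Suc k)) \<le> \<bar>norm (?E k) + norm (\<epsilon> (Suc k))\<bar>"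
      using norm_triangle_ineq abs_ge_self by (rule order_trans)
    then show "norm (norm ((z (Suc k) - z k) - (L (z k - z0) - (z k - z0)))) \<le> norm (norm (?E k) + norm (\<epsilon> (Suc k)))"
      unfolding eq by (simp only: real_norm_def abs_norm_cancel)
  qed
  ultimately show ?thesis by (rule landau_o.big_small_trans[rotated])
qed

section \<open>Discrete total variation and the l1 norm\<close>

lemma adjoint_vec_eq_sum:
  fixes D :: "'a::euclidean_space \<Rightarrow> 'b::euclidean_space ^ 'm"
  assumes D: "linear D"
  shows "linear (\<lambda>x. D x $ r)" and "adjoint D q = (\<Sum>r\<in>UNIV. adjoint (\<lambda>x. D x $ r) (q $ r))"
proof -
  show lin: "linear (\<lambda>x. D x $ r)" for r
    using D by (intro linearI) (simp_all add: linear_add linear_scale)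
  have "x \<bullet> adjoint D q = x \<bullet> (\<Sum>r\<in>UNIV. adjoint (\<lambda>x. D x $ r) (q $ r))" for x
    by (simp add: adjoint_works[OF D] adjoint_works[OF lin] inner_vec_def inner_sum_right)
  then show "adjoint D q = (\<Sum>r\<in>UNIV. adjoint (\<lambda>x. D x $ r) (q $ r))"
    using vector_eq_ldot by blast
qed

text \<open>The components of \<open>D\<close> serve as the family of linear maps, and the adjoint
  of \<open>D\<close> splits accordingly. Real blocks give anisotropic total variation.\<close>

lemma prox_differentiable_group_norm:
  fixes D :: "'a::euclidean_space \<Rightarrow> 'b::euclidean_space ^ 'm"
  assumes D: "linear D" and lam: "lam > 0"
    and g: "proper_closed_convex g" and \<gamma>: "\<gamma> > 0"
    and geq: "g = (\<lambda>x. ereal (lam * (\<Sum>r\<in>UNIV. norm (D x $ r))))"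
    and v0: "v0 = lam *\<^sub>R adjoint D q" and w: "w = p + \<gamma> *\<^sub>R v0"
    and q: "\<And>r. D p $ r \<noteq> 0 \<Longrightarrow> q $ r = (D p $ r) /\<^sub>R norm (D p $ r)"
      "\<And>r. D p $ r = 0 \<Longrightarrow> norm (q $ r) < 1"
  shows "prox \<gamma> g differentiable (at w)"
  by (rule prox_differentiable_sum_norm[where q = "\<lambda>r. q $ r", OF finite adjoint_vec_eq_sum(1)[OF D] lam g \<gamma> geq _ w])
    (simp_all add: v0 adjoint_vec_eq_sum(2)[OF D] q)

lemma l1_norm_subgradient_inner:
  fixes p :: "'a::euclidean_space"
  assumes v: "v \<in> subdifferential (\<lambda>x. ereal (lam * l1_norm x)) p" and i: "i \<in> Basis"
  shows "(v \<bullet> i) * (p \<bullet> i) = lam * \<bar>p \<bullet> i\<bar>"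
proof -
  have l1: "l1_norm (p + t *\<^sub>R i) = l1_norm p + (\<bar>p \<bullet> i + t\<bar> - \<bar>p \<bullet> i\<bar>)" for t
  proof -
    have "(\<Sum>j\<in>Basis - {i}. \<bar>(p + t *\<^sub>R i) \<bullet> j\<bar>) = (\<Sum>j\<in>Basis - {i}. \<bar>p \<bullet> j\<bar>)"
      using i by (intro sum.cong refl) (auto simp: inner_add_left inner_not_same_Basis)
    then show ?thesis using i
      by (simp add: l1_norm_def sum.remove[OF finite_Basis i] inner_add_left)
  qed
  have *: "t * (v \<bullet> i) \<le> lam * (\<bar>p \<bullet> i + t\<bar> - \<bar>p \<bullet> i\<bar>)" for t
  proof -
    have "ereal (lam * l1_norm p) + ereal (v \<bullet> (p + t *\<^sub>R i - p)) \<le> ereal (lam * l1_norm (p + t *\<^sub>R i))"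
      using v unfolding subdifferential_def by blast
    then show ?thesis by (simp add: l1 distrib_left)
  qed
  have "\<bar>p \<bullet> i + p \<bullet> i\<bar> - \<bar>p \<bullet> i\<bar> = \<bar>p \<bullet> i\<bar>" by simp
  \<comment> \<open>Doubling the coordinate gives one inequality and setting it to zero gives the
    other.\<close>
  then show ?thesis using *[of "p \<bullet> i"] *[of "- (p \<bullet> i)"] by (simp add: mult.commute)
qed

text \<open>The maps are the coordinates, which forces the certificate
  \<open>v0 \<bullet> i / lam\<close>. At nonzero coordinates its value is the sign, because
  \<open>v0\<close> is a subgradient.\<close>

lemma prox_differentiable_l1_norm:
  fixes p :: "'a::euclidean_space"
  assumes lam: "lam > 0" and g: "proper_closed_convex g" and \<gamma>: "\<gamma> > 0"
    and geq: "g = (\<lambda>x. ereal (lam * l1_norm x))"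
    and v0: "v0 \<in> subdifferential g p" and w: "w = p + \<gamma> *\<^sub>R v0"
    and q: "\<And>i. i \<in> Basis \<Longrightarrow> p \<bullet> i = 0 \<Longrightarrow> \<bar>v0 \<bullet> i\<bar> < lam"
  shows "prox \<gamma> g differentiable (at w)"
proof (rule prox_differentiable_sum_norm[where I = Basis and A = "\<lambda>i x. x \<bullet> i"
      and q = "\<lambda>i. (v0 \<bullet> i) / lam", OF finite_Basis _ lam g \<gamma> _ _ w])
  show "linear (\<lambda>x::'a. x \<bullet> i)" for i by (intro linearI) (simp_all add: inner_add_left)
  show "g = (\<lambda>x. ereal (lam * (\<Sum>i\<in>Basis. norm (x \<bullet> i))))" by (simp add: geq l1_norm_def)
  have "adjoint (\<lambda>x::'a. x \<bullet> i) = (\<lambda>t. t *\<^sub>R i)" for i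
    by (rule adjoint_unique) (simp add: mult.commute)
  then show "v0 = lam *\<^sub>R (\<Sum>i\<in>Basis. adjoint (\<lambda>x. x \<bullet> i) ((v0 \<bullet> i) / lam))"
    using lam by (simp add: scaleR_sum_right euclidean_representation)
  fix i :: 'a assume i: "i \<in> Basis"
  show "norm ((v0 \<bullet> i) / lam) < 1" if "p \<bullet> i = 0" using q[OF i that] lam by simp
  assume nz: "p \<bullet> i \<noteq> 0"
  have "(v0 \<bullet> i) * (p \<bullet> i) = lam * \<bar>p \<bullet> i\<bar>"
    using v0 unfolding geq by (rule l1_norm_subgradient_inner[OF _ i])
  then have "(v0 \<bullet> i) * (p \<bullet> i) = (lam * sgn (p \<bullet> i)) * (p \<bullet> i)"
    by (simp add: abs_sgn mult.commute)
  then have "v0 \<bullet> i = lam * sgn (p \<bullet> i)" unfolding mult_right_cancel[OF nz] .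
  then show "(v0 \<bullet> i) / lam = (p \<bullet> i) /\<^sub>R norm (p \<bullet> i)"
    using lam by (simp add: sgn_div_norm)
qed

theorem proposition5p5:
  fixes f :: "'a::euclidean_space \<Rightarrow> real" and g :: "'a \<Rightarrow> ereal"
    and \<sigma> \<beta> \<gamma> \<alpha> \<delta> :: real
    and z\<^sub>s p\<^sub>s w\<^sub>s :: 'a
    and T G Q L :: "'a \<Rightarrow> 'a"
  assumes "convex_on UNIV f" and "C2_on UNIV f"
    and "0 < \<sigma>" and "\<sigma> \<le> \<beta>"
    and "strongly_convex \<sigma> f"
    and "\<beta>-lipschitz_on UNIV (gradient f)"
    and "proper_closed_convex g"
    and "\<gamma> > 0" and "\<alpha> > 0"
  defines "\<delta> \<equiv> max ((\<gamma> * \<beta> - 1) / (\<gamma> * \<beta> + 1)) ((1 - \<gamma> * \<sigma>) / (1 + \<gamma> * \<sigma>))"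
  assumes "\<bar>1 - \<alpha>\<bar> + \<alpha> * \<delta> < 1"
  defines "T \<equiv> drs_map \<alpha> \<gamma> (\<lambda>x. ereal (f x)) g"
  assumes "{z. T z = z} = {z\<^sub>s}"
  defines "p\<^sub>s \<equiv> prox \<gamma> (\<lambda>x. ereal (f x)) z\<^sub>s"
    and "w\<^sub>s \<equiv> reflected_prox \<gamma> (\<lambda>x. ereal (f x)) z\<^sub>s"
    and "G \<equiv> (\<lambda>v. v + \<gamma> *\<^sub>R hessian f p\<^sub>s v)"
    and "L \<equiv> (\<lambda>v. (1 - \<alpha>) *\<^sub>R v +
                \<alpha> *\<^sub>R (let u = 2 *\<^sub>R inv G v - v in 2 *\<^sub>R Q u - u))"
  shows
    "((prox \<gamma> g has_derivative Q) (at w\<^sub>s) \<longrightarrow>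
        bij G \<and>
        (T has_derivative L) (at z\<^sub>s) \<and>
        (\<lambda>x. norm ((T x - x) - (L (x - z\<^sub>s) - (x - z\<^sub>s)))) \<in> o[at z\<^sub>s](\<lambda>x. norm (x - z\<^sub>s)) \<and>
        (\<forall>z :: nat \<Rightarrow> 'a. (\<forall>k. z (Suc k) = T (z k)) \<longrightarrow>
           (\<lambda>k. norm ((z (Suc k) - z k) - (L (z k - z\<^sub>s) - (z k - z\<^sub>s))))
             \<in> o(\<lambda>k. norm (z k - z\<^sub>s))) \<and>
        (\<forall>(z :: nat \<Rightarrow> 'a) (\<epsilon> :: nat \<Rightarrow> 'a).
           (\<forall>k. z (Suc k) = T (z k) + \<epsilon> (Suc k)) \<and>
           (\<lambda>k. norm (\<epsilon> (Suc k))) \<in> o(\<lambda>k. norm (z k - z\<^sub>s)) \<longrightarrow>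
           (\<lambda>k. norm ((z (Suc k) - z k) - (L (z k - z\<^sub>s) - (z k - z\<^sub>s))))
             \<in> o(\<lambda>k. norm (z k - z\<^sub>s))))
     \<and> (\<forall>M V. locally_affine_manifold M p\<^sub>s V \<and> partly_smooth g p\<^sub>s M V \<and>
           C2_near M p\<^sub>s g \<and>
           - gradient f p\<^sub>s \<in> rel_interior (subdifferential g p\<^sub>s)
         \<longrightarrow> prox \<gamma> g differentiable (at w\<^sub>s))
     \<and> (\<forall>lam > 0. g = (\<lambda>x. ereal (lam * l1_norm x)) \<and>
           (\<forall>i\<in>Basis. p\<^sub>s \<bullet> i = 0 \<longrightarrow> \<bar>gradient f p\<^sub>s \<bullet> i\<bar> < lam)
         \<longrightarrow> prox \<gamma> g differentiable (at w\<^sub>s))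
     \<and> (\<forall>lam > 0. \<forall>(D :: 'a \<Rightarrow> real ^ 'n) q.
           linear D \<and> g = (\<lambda>x. ereal (lam * l1_norm (D x))) \<and>
           - gradient f p\<^sub>s = lam *\<^sub>R adjoint D q \<and>
           (\<forall>j. D p\<^sub>s $ j \<noteq> 0 \<longrightarrow> q $ j = sgn (D p\<^sub>s $ j)) \<and>
           (\<forall>j. D p\<^sub>s $ j = 0 \<longrightarrow> \<bar>q $ j\<bar> < 1)
         \<longrightarrow> prox \<gamma> g differentiable (at w\<^sub>s))
     \<and> (\<forall>lam > 0. \<forall>(D :: 'a \<Rightarrow> ('b::euclidean_space) ^ 'm) q.
           linear D \<and> g = (\<lambda>x. ereal (lam * (\<Sum>r\<in>UNIV. norm (D x $ r)))) \<and>
           - gradient f p\<^sub>s = lam *\<^sub>R adjoint D q \<and>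
           (\<forall>r. D p\<^sub>s $ r \<noteq> 0 \<longrightarrow> q $ r = (D p\<^sub>s $ r) /\<^sub>R norm (D p\<^sub>s $ r)) \<and>
           (\<forall>r. D p\<^sub>s $ r = 0 \<longrightarrow> norm (q $ r) < 1)
         \<longrightarrow> prox \<gamma> g differentiable (at w\<^sub>s))"
proof -
  let ?f = "\<lambda>x. ereal (f x)"
  note g = \<open>proper_closed_convex g\<close> and \<gamma> = \<open>\<gamma> > 0\<close> and f = \<open>convex_on UNIV f\<close>
  note \<sigma> = \<open>0 < \<sigma>\<close> \<open>\<sigma> \<le> \<beta>\<close> and sc = \<open>strongly_convex \<sigma> f\<close>
  note f' = C2_gradient_derivatives(1)[OF \<open>C2_on UNIV f\<close>]
    and hess = C2_gradient_derivatives(2)[OF \<open>C2_on UNIV f\<close>]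
  have fp: "T z\<^sub>s = z\<^sub>s" using \<open>{z. T z = z} = {z\<^sub>s}\<close> by blast
  have T: "norm (T x - T y) \<le> (\<bar>1 - \<alpha>\<bar> + \<alpha> * \<delta>) * norm (x - y)" for x y
    unfolding T_def \<delta>_def
    by (intro drs_map_lipschitz[OF g \<gamma>]
        reflected_prox_contraction[OF f f' \<gamma> \<sigma> sc \<open>\<beta>-lipschitz_on UNIV (gradient f)\<close>])
      (use \<open>\<alpha> > 0\<close> in simp)
  note prox_f = smooth_prox_has_derivative[OF f f' \<gamma> gradient_monotone[OF sc less_imp_le[OF \<sigma>(1)] f']
      meta_eq_to_obj_eq[OF p\<^sub>s_def] hess, folded G_def]
  define v0 where "v0 = - gradient f p\<^sub>s"
  have z: "z\<^sub>s = p\<^sub>s + \<gamma> *\<^sub>R gradient f p\<^sub>s"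
    by (rule smooth_prox_eq[OF f f' \<gamma> meta_eq_to_obj_eq[OF p\<^sub>s_def]])
  have w2: "w\<^sub>s = 2 *\<^sub>R p\<^sub>s - z\<^sub>s" by (simp add: w\<^sub>s_def reflected_prox_def p\<^sub>s_def)
  then have w: "w\<^sub>s = p\<^sub>s + \<gamma> *\<^sub>R v0" by (subst (asm) z) (simp add: v0_def scaleR_2)
  \<comment> \<open>Cancelling \<open>\<alpha>\<close>, the fixed point equation says that
    reflecting \<open>w\<^sub>s\<close> gives \<open>z\<^sub>s\<close>; hence both proxes yield the
    same point \<open>p\<^sub>s\<close>.\<close>
  have "(1 - \<alpha>) *\<^sub>R z\<^sub>s + \<alpha> *\<^sub>R reflected_prox \<gamma> g w\<^sub>s = z\<^sub>s"
    using fp by (simp add: T_def drs_map_def w\<^sub>s_def)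
  moreover have "\<alpha> *\<^sub>R (2 *\<^sub>R prox \<gamma> g w\<^sub>s - w\<^sub>s - z\<^sub>s)
      = ((1 - \<alpha>) *\<^sub>R z\<^sub>s + \<alpha> *\<^sub>R reflected_prox \<gamma> g w\<^sub>s) - z\<^sub>s"
    by (simp add: reflected_prox_def algebra_simps)
  ultimately have "\<alpha> *\<^sub>R (2 *\<^sub>R prox \<gamma> g w\<^sub>s - w\<^sub>s - z\<^sub>s) = 0" by simp
  then have "2 *\<^sub>R prox \<gamma> g w\<^sub>s - w\<^sub>s - z\<^sub>s = 0"
    unfolding scaleR_eq_0_iff using \<open>\<alpha> > 0\<close> by simp
  then have "2 *\<^sub>R prox \<gamma> g w\<^sub>s = 2 *\<^sub>R p\<^sub>s" by (simp add: w2)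
  then have pg: "prox \<gamma> g w\<^sub>s = p\<^sub>s" by simp
  \<comment> \<open>The optimality condition: minus the gradient of \<open>f\<close> is a
    subgradient of \<open>g\<close> at the solution.\<close>
  have v0: "v0 \<in> subdifferential g p\<^sub>s"
    using prox_subdifferential[OF g \<gamma>, of w\<^sub>s] \<gamma> unfolding pg by (simp add: w)
  show ?thesis
  proof (intro conjI allI impI)
    assume Q: "(prox \<gamma> g has_derivative Q) (at w\<^sub>s)"
    show "bij G" by (rule prox_f)
    show L: "(T has_derivative L) (at z\<^sub>s)" unfolding T_def L_def
      by (rule drs_map_has_derivative[OF prox_f(2)]) (use Q in \<open>simp add: w\<^sub>s_def\<close>)
    show "(\<lambda>x. norm ((T x - x) - (L (x - z\<^sub>s) - (x - z\<^sub>s)))) \<in> o[at z\<^sub>s](\<lambda>x. norm (x - z\<^sub>s))"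
      by (rule fixed_point_expansion[OF L fp tendsto_ident_at])
    note expansion = perturbed_iteration_expansion[OF T \<open>\<bar>1 - \<alpha>\<bar> + \<alpha> * \<delta> < 1\<close> fp L]
    show "(\<lambda>k. norm ((z (Suc k) - z k) - (L (z k - z\<^sub>s) - (z k - z\<^sub>s)))) \<in> o(\<lambda>k. norm (z k - z\<^sub>s))"
      if "\<forall>k. z (Suc k) = T (z k)" for z
      by (rule expansion[where \<epsilon> = "\<lambda>_. 0"]) (use that in simp_all)
    show "(\<lambda>k. norm ((z (Suc k) - z k) - (L (z k - z\<^sub>s) - (z k - z\<^sub>s)))) \<in> o(\<lambda>k. norm (z k - z\<^sub>s))"
      if "(\<forall>k. z (Suc k) = T (z k) + \<epsilon> (Suc k)) \<and> (\<lambda>k. norm (\<epsilon> (Suc k))) \<in> o(\<lambda>k. norm (z k - z\<^sub>s))"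
      for z \<epsilon> :: "nat \<Rightarrow> 'a"
      by (rule expansion[where \<epsilon> = \<epsilon>]) (use that in simp_all)
  next
    fix M V
    assume "locally_affine_manifold M p\<^sub>s V \<and> partly_smooth g p\<^sub>s M V \<and> C2_near M p\<^sub>s g \<and>
      - gradient f p\<^sub>s \<in> rel_interior (subdifferential g p\<^sub>s)"
    then show "prox \<gamma> g differentiable (at w\<^sub>s)"
      using prox_differentiable_if_partly_smooth[OF g \<gamma> _ _ _ w] unfolding v0_def by blast
  next
    fix lam :: real
    assume "lam > 0"
      "g = (\<lambda>x. ereal (lam * l1_norm x)) \<and> (\<forall>i\<in>Basis. p\<^sub>s \<bullet> i = 0 \<longrightarrow> \<bar>gradient f p\<^sub>s \<bullet> i\<bar> < lam)"
    then show "prox \<gamma> g differentiable (at w\<^sub>s)"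
      by (intro prox_differentiable_l1_norm[OF _ g \<gamma> _ v0 w]) (auto simp: v0_def)
  next
    fix lam :: real and D :: "'a \<Rightarrow> real ^ 'n" and q
    assume lam: "lam > 0" and *: "linear D \<and> g = (\<lambda>x. ereal (lam * l1_norm (D x))) \<and>
      - gradient f p\<^sub>s = lam *\<^sub>R adjoint D q \<and>
      (\<forall>j. D p\<^sub>s $ j \<noteq> 0 \<longrightarrow> q $ j = sgn (D p\<^sub>s $ j)) \<and> (\<forall>j. D p\<^sub>s $ j = 0 \<longrightarrow> \<bar>q $ j\<bar> < 1)"
    show "prox \<gamma> g differentiable (at w\<^sub>s)"
    \<comment> \<open>One-dimensional blocks: the sign is the normalized vector and the absolute
      value the norm.\<close>
    proof (rule prox_differentiable_group_norm[OF _ lam g \<gamma> _ _ w])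
      show "g = (\<lambda>x. ereal (lam * (\<Sum>r\<in>UNIV. norm (D x $ r))))" using * by (simp add: l1_norm_vec)
      show "v0 = lam *\<^sub>R adjoint D q" using * by (simp add: v0_def)
      show "q $ r = (D p\<^sub>s $ r) /\<^sub>R norm (D p\<^sub>s $ r)" if "D p\<^sub>s $ r \<noteq> 0" for r
        using * that by (simp add: sgn_div_norm)
    qed (use * in auto)
  next
    fix lam :: real and D :: "'a \<Rightarrow> 'b ^ 'm" and q
    assume lam: "lam > 0" and *: "linear D \<and> g = (\<lambda>x. ereal (lam * (\<Sum>r\<in>UNIV. norm (D x $ r)))) \<and>
      - gradient f p\<^sub>s = lam *\<^sub>R adjoint D q \<and>
      (\<forall>r. D p\<^sub>s $ r \<noteq> 0 \<longrightarrow> q $ r = (D p\<^sub>s $ r) /\<^sub>R norm (D p\<^sub>s $ r)) \<and>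
      (\<forall>r. D p\<^sub>s $ r = 0 \<longrightarrow> norm (q $ r) < 1)"
    show "prox \<gamma> g differentiable (at w\<^sub>s)"
    proof (rule prox_differentiable_group_norm[OF _ lam g \<gamma> _ _ w])
      show "v0 = lam *\<^sub>R adjoint D q" using * by (simp add: v0_def)
    qed (use * in auto)
  qed
qed

end
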